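(* Let $G$ be a finite simple graph such that $\chi(G)-\omega(G)\ge 3$ and $|V(G)|=\chi(G)+6$. Then either $\chi(G)\ge 7$ and $G$ is isomorphic to $K_{\chi(G)-7}+Q$, or $\chi(G)\ge 9$ and $G$ is isomorphic to $K_{\chi(G)-9}+C_5+C_5+C_5$.
   Context: All graphs are finite, undirected, without loops or multiple edges. $\chi(G)$ is the chromatic number and $\omega(G)$ the clique number (largest size of a set of pairwise adjacent vertices). $K_n$ is the complete graph on $n$ vertices ($K_0$ is the empty graph, so $K_0+H=H$), and $C_5$ is the 5-cycle. For graphs $G_1,G_2$, the join $G_1+G_2$ is the graph on the disjoint union $V(G_1)\cup V(G_2)$ whose edges are those of $G_1$, those of $G_2$, and all edges $xy$ with $x\in V(G_1)$, $y\in V(G_2)$; the join is associative. $Q$ is the 13-vertex graph with vertex set $\mathbb{Z}_{13}$ in which distinct $i,j$ are adjacent iff $i-j\notin\{\pm1,\pm5\}\pmod{13}$; i.e. the complement $\overline{Q}$ is the circulant graph on $\mathbb{Z}_{13}$ with connection set $\{\pm1,\pm5\}$. *)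

theory Defs
  imports "Graph_Theory.Graph_Theory" "HOL-Number_Theory.Cong"
begin

text \<open>
  Finite simple undirected graphs are the library's \<^locale>\<open>pair_graph\<close>s: finite symmetric
  loop-free digraphs whose arcs are ordered pairs of vertices, an edge \<open>uv\<close> being represented by
  the two arcs \<open>(u,v)\<close> and \<open>(v,u)\<close>.  The null graph is allowed.
\<close>

definition proper_coloring :: "'a pair_pre_digraph \<Rightarrow> nat \<Rightarrow> ('a \<Rightarrow> nat) \<Rightarrow> bool" where
  "proper_coloring G k c \<longleftrightarrow>
     (\<forall>v\<in>pverts G. c v < k) \<and> (\<forall>(u,v)\<in>parcs G. c u \<noteq> c v)"

definition chromatic_number :: "'a pair_pre_digraph \<Rightarrow> nat" where
  "chromatic_number G = (LEAST k. \<exists>c. proper_coloring G k c)"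

definition clique :: "'a pair_pre_digraph \<Rightarrow> 'a set \<Rightarrow> bool" where
  "clique G S \<longleftrightarrow> S \<subseteq> pverts G \<and> (\<forall>u\<in>S. \<forall>v\<in>S. u \<noteq> v \<longrightarrow> (u,v) \<in> parcs G)"

definition clique_number :: "'a pair_pre_digraph \<Rightarrow> nat" where
  "clique_number G = Max (card ` {S. clique G S})"

definition complete_graph :: "nat \<Rightarrow> nat pair_pre_digraph" where
  "complete_graph n =
     \<lparr> pverts = {0..<n}, parcs = {(i,j). i < n \<and> j < n \<and> i \<noteq> j} \<rparr>"

text \<open>Intended for \<open>n \<ge> 3\<close>.\<close>

definition cycle_graph :: "nat \<Rightarrow> nat pair_pre_digraph" where
  "cycle_graph n =
     \<lparr> pverts = {0..<n},
       parcs = {(i,j). i < n \<and> j < n \<and> (j = Suc i mod n \<or> i = Suc j mod n)} \<rparr>"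

text \<open>The residues modulo 13 are represented by the integers \<open>0, \<dots>, 12\<close>.\<close>

definition Q_graph :: "int pair_pre_digraph" where
  "Q_graph =
     \<lparr> pverts = {0..<13},
       parcs = {(i,j). i \<in> {0..<13} \<and> j \<in> {0..<13} \<and> i \<noteq> j \<and>
                  (\<forall>s\<in>{1, -1, 5, -5}. \<not> [i - j = s] (mod 13))} \<rparr>"

definition graph_join ::
    "'a pair_pre_digraph \<Rightarrow> 'b pair_pre_digraph \<Rightarrow> ('a + 'b) pair_pre_digraph"
    (infixl \<open>+\<^sub>G\<close> 65) where
  "G +\<^sub>G H =
     \<lparr> pverts = pverts G <+> pverts H,
       parcs = map_prod Inl Inl ` parcs G \<union> map_prod Inr Inr ` parcs H
             \<union> Inl ` pverts G \<times> Inr ` pverts H \<union> Inr ` pverts H \<times> Inl ` pverts G \<rparr>"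

text \<open>
  For the library's \<^const>\<open>digraph_iso\<close> the arc bijection is determined by the vertex bijection
  as soon as arcs are pairs, so it is the usual isomorphism of simple graphs.
\<close>

abbreviation graph_iso :: "'a pair_pre_digraph \<Rightarrow> 'b pair_pre_digraph \<Rightarrow> bool"
    (infix \<open>\<cong>\<^sub>G\<close> 50) where
  "G \<cong>\<^sub>G H \<equiv> digraph_iso (with_proj G) (with_proj H)"

lemma graph_iso_iff:
  assumes "pair_graph G" "pair_graph H"
  shows "G \<cong>\<^sub>G H \<longleftrightarrow> (\<exists>f. bij_betw f (pverts G) (pverts H) \<and>
           (\<forall>u\<in>pverts G. \<forall>v\<in>pverts G. (u,v) \<in> parcs G \<longleftrightarrow> (f u, f v) \<in> parcs H))"
    (is "?L \<longleftrightarrow> ?R")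
proof
  interpret G: pair_graph G by fact
  assume ?L
  then obtain h where h: "pre_digraph.digraph_isomorphism (with_proj G) h"
    and H: "with_proj H = app_iso h (with_proj G)"
    unfolding digraph_iso_def by blast
  let ?f = "iso_verts h" and ?g = "iso_arcs h"
  have inj: "inj_on ?f (pverts G)"
    using h by (simp add: pre_digraph.digraph_isomorphism_def)
  have V: "pverts H = ?f ` pverts G" and A: "parcs H = ?g ` parcs G"
    and T: "iso_tail h = fst" and D: "iso_head h = snd"
    using H by (simp_all add: with_proj_def app_iso_def)
  have g: "?g a = (?f (fst a), ?f (snd a))" if "a \<in> parcs G" for a
    using h that T D
    by (auto simp: pre_digraph.digraph_isomorphism_def intro: prod_eqI)
  have "(u,v) \<in> parcs G \<longleftrightarrow> (?f u, ?f v) \<in> parcs H"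
    if uv: "u \<in> pverts G" "v \<in> pverts G" for u v
  proof
    assume "(u,v) \<in> parcs G" then show "(?f u, ?f v) \<in> parcs H"
      using A g by force
  next
    assume "(?f u, ?f v) \<in> parcs H"
    then obtain a where a: "a \<in> parcs G" "(?f u, ?f v) = ?g a" using A by auto
    moreover have "fst a \<in> pverts G" "snd a \<in> pverts G"
      using a(1) G.in_arcsD1 G.in_arcsD2 by (metis prod.collapse)+
    ultimately have "a = (u,v)" using g uv inj by (auto simp: inj_on_eq_iff intro: prod_eqI)
    then show "(u,v) \<in> parcs G" using a by simp
  qed
  then show ?R using inj V by (intro exI[of _ ?f]) (auto simp: bij_betw_def)
next
  interpret G: pair_graph G by fact
  interpret H: pair_graph H by fact
  assume ?R
  then obtain f where f: "bij_betw f (pverts G) (pverts H)"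
    and E: "\<And>u v. u \<in> pverts G \<Longrightarrow> v \<in> pverts G \<Longrightarrow> (u,v) \<in> parcs G \<longleftrightarrow> (f u, f v) \<in> parcs H"
    by blast
  have inj: "inj_on f (pverts G)" and V: "f ` pverts G = pverts H"
    using f by (auto simp: bij_betw_def)
  let ?h = "\<lparr> iso_verts = f, iso_arcs = map_prod f f, iso_head = snd, iso_tail = fst \<rparr>"
  have in_verts: "\<And>u v. (u,v) \<in> parcs G \<Longrightarrow> u \<in> pverts G \<and> v \<in> pverts G"
    using G.in_arcsD1 G.in_arcsD2 by blast
  have "inj_on (map_prod f f) (parcs G)"
  proof (rule inj_onI)
    fix a b assume "a \<in> parcs G" "b \<in> parcs G" "map_prod f f a = map_prod f f b"
    then show "a = b" using in_verts inj
      by (cases a; cases b) (auto simp: inj_on_eq_iff)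
  qed
  then have "pre_digraph.digraph_isomorphism (with_proj G) ?h"
    using inj G.wf_digraph by (simp add: pre_digraph.digraph_isomorphism_def)
  moreover have "map_prod f f ` parcs G = parcs H"
  proof
    show "map_prod f f ` parcs G \<subseteq> parcs H" using in_verts E by auto
    show "parcs H \<subseteq> map_prod f f ` parcs G"
    proof
      fix a assume a: "a \<in> parcs H"
      then obtain x y where xy: "a = (x,y)" "x \<in> pverts H" "y \<in> pverts H"
        using H.in_arcsD1 H.in_arcsD2 by (metis prod.collapse)
      then obtain u v where uv: "x = f u" "y = f v" "u \<in> pverts G" "v \<in> pverts G"
        using V by blast
      then have "(u,v) \<in> parcs G" using E a xy by simp
      then show "a \<in> map_prod f f ` parcs G" using xy uv by force
    qed
  qed
  then have "with_proj H = app_iso ?h (with_proj G)"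
    using V by (simp add: with_proj_def app_iso_def)
  ultimately show ?L unfolding digraph_iso_def by blast
qed

lemma pair_graphI_sym:
  assumes "finite (pverts G)" "parcs G \<subseteq> pverts G \<times> pverts G"
    and "\<And>u v. (u,v) \<in> parcs G \<Longrightarrow> u \<noteq> v \<and> (v,u) \<in> parcs G"
  shows "pair_graph G"
proof -
  have fin: "finite (parcs G)" using assms(1,2) by (meson finite_SigmaI finite_subset)
  show ?thesis
  proof
    show "symmetric (with_proj G)"
      using assms(3) by (auto simp: symmetric_def arcs_ends_def arc_to_ends_def intro!: symI)
  qed (use assms fin in auto)
qed

lemma complete_digraph_complete_graph: "K\<^bsub>n\<^esub> (with_proj (complete_graph n))"
  by (auto simp: complete_digraph_pair_def complete_graph_def)

lemma pair_graph_complete_graph: "pair_graph (complete_graph n)"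
  using complete_digraph_complete_graph by (rule pair_graphI_complete)

lemma pair_graph_cycle_graph:
  assumes "n \<ge> 3"
  shows "pair_graph (cycle_graph n)"
proof (rule pair_graphI_sym)
  fix u v assume "(u,v) \<in> parcs (cycle_graph n)"
  then show "u \<noteq> v \<and> (v,u) \<in> parcs (cycle_graph n)"
    using assms by (auto simp: cycle_graph_def mod_Suc split: if_splits)
qed (auto simp: cycle_graph_def)

lemma pair_graph_Q_graph: "pair_graph Q_graph"
proof (rule pair_graphI_sym)
  have flip: "[j - i = s] (mod 13) \<longleftrightarrow> [i - j = - s] (mod 13)" for i j s :: int
    using cong_minus_minus_iff[of "j - i" s 13] by simp
  fix u v assume "(u,v) \<in> parcs Q_graph"
  then show "u \<noteq> v \<and> (v,u) \<in> parcs Q_graph"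
    by (auto simp: Q_graph_def flip[of v u])
qed (auto simp: Q_graph_def)

lemma pair_graph_graph_join:
  assumes "pair_graph G" "pair_graph H"
  shows "pair_graph (G +\<^sub>G H)"
proof -
  interpret G: pair_graph G by fact
  interpret H: pair_graph H by fact
  show ?thesis
  proof (rule pair_graphI_sym)
    show "parcs (G +\<^sub>G H) \<subseteq> pverts (G +\<^sub>G H) \<times> pverts (G +\<^sub>G H)"
      using G.in_arcsD1 G.in_arcsD2 H.in_arcsD1 H.in_arcsD2
      by (auto simp: graph_join_def; blast)
  next
    fix u v assume "(u,v) \<in> parcs (G +\<^sub>G H)"
    then show "u \<noteq> v \<and> (v,u) \<in> parcs (G +\<^sub>G H)"
      using G.no_loops H.no_loops G.arcs_symmetric H.arcs_symmetric
      by (fastforce simp: graph_join_def)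
  qed (auto simp: graph_join_def)
qed

end

theory Submission
  imports Defs "HOL-Library.Disjoint_Sets"
begin

text \<open>
  In the complement \<open>E\<close> of \<open>G\<close>, colour classes are cliques and cliques are independent sets.
  Write \<open>n = |V|\<close>; then every family of disjoint cliques \<open>K\<close> of \<open>E\<close> has
  \<open>\<Sum>(|K| - 1) \<le> 2k\<close>, and independent sets have at most \<open>n - 3k\<close> vertices, where \<open>k = 3\<close>.
  Graphs with this property for some \<open>k \<le> 2\<close> are \<open>k\<close> disjoint 5-cycles plus isolated vertices, by
  induction on \<open>k\<close>.  Deleting a triangle gives the property for \<open>k - 1\<close>, and the known structure of the
  rest excludes the triangle.  For triangle-free \<open>E\<close>, clique families are matchings.  Vertices
  covered by all maximum matchings can be deleted, after which Gallai's lemma splits the graph into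
  pieces with \<open>2\<nu> + 1\<close> vertices and matching number \<open>\<nu> \<le> 2k \<le> 6\<close>.  The Ramsey bounds
  \<open>R(3,3) \<le> 6\<close> and \<open>R(3,4) \<le> 9\<close> show that a piece has vertex cover number at most \<open>3\<nu>/2\<close>, with equality
  only for a single vertex, a 5-cycle, or a 13-vertex graph without independent sets of size 5; the
  latter is the unique extremal graph for \<open>R(3,5) = 14\<close>, the complement of \<open>Q\<close>.
\<close>

text \<open>What decides the outcome is an inequality without slack. A matching of size \<nu> is a
  clique family with \<Sum>(|K| - 1) = \<nu>, hence \<nu> \<le> 2k, whereas the bound on independent
  sets says that every vertex cover has at least 3k vertices. A cover number of at most 3\<nu>/2 in
  every piece therefore forces equality everywhere, and each piece must be extremal. The extremal
  orders 1, 5, 13 have \<nu> = 0, 2, 6; a total of 6 leaves three 5-cycles or a single 13-vertex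
  piece, and for k \<le> 2 the total is too small for the latter. A triangle is the obstacle: it
  needs 2 cover vertices for \<nu> = 1, which violates the ratio 3/2. This is why triangles are
  excluded before matchings are used, and why the induction on k has to describe the remaining graph
  exactly.\<close>

section \<open>Orbits of involutions\<close>

lemma card_involution_orbits:
  assumes "finite A" "f ` A \<subseteq> A" "\<And>x. x \<in> A \<Longrightarrow> f (f x) = x"
  shows "2 * card ((\<lambda>x. {x, f x}) ` A) = card A + card {x\<in>A. f x = x}"
  using assms
proof (induction A rule: finite_psubset_induct)
  case (psubset A)
  show ?case
  proof (cases "A = {}")
    case False
    then obtain x where x: "x \<in> A" by blast
    define B where "B = A - {x, f x}"
    have fx: "f x \<in> A" "f (f x) = x" using x psubset.prems by auto
    have A: "A = B \<union> {x, f x}" "B \<inter> {x, f x} = {}" using x fx by (auto simp: B_def)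
    have fB: "finite B" using psubset.hyps by (simp add: B_def)
    have "f ` B \<subseteq> B"
    proof safe
      fix y assume "y \<in> B"
      then have "y \<in> A" "y \<noteq> x" "y \<noteq> f x" "f (f y) = y" "f y \<in> A" using psubset.prems A by auto
      moreover from this have "f y \<noteq> x" "f y \<noteq> f x" using fx by metis+
      ultimately show "f y \<in> B" by (simp add: B_def)
    qed
    moreover have "B \<subset> A" using x by (auto simp: B_def)
    ultimately have IH: "2 * card ((\<lambda>x. {x, f x}) ` B) = card B + card {x\<in>B. f x = x}"
      using psubset.IH[of B] psubset.prems by (auto simp: B_def)
    have "(\<lambda>x. {x, f x}) ` A = insert {x, f x} ((\<lambda>x. {x, f x}) ` B)"
      unfolding A(1) image_Un using fx by auto
    moreover have "{x, f x} \<notin> (\<lambda>x. {x, f x}) ` B" using A(2) by blast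
    ultimately have 1: "card ((\<lambda>x. {x, f x}) ` A) = Suc (card ((\<lambda>x. {x, f x}) ` B))"
      using fB by simp
    show ?thesis
    proof (cases "f x = x")
      case True
      then have "A = insert x B" "{z\<in>A. f z = z} = insert x {z\<in>B. f z = z}" "x \<notin> B"
        using A by auto
      then have "card A = Suc (card B)" "card {z\<in>A. f z = z} = Suc (card {z\<in>B. f z = z})"
        using fB by simp_all
      then show ?thesis using 1 IH by simp
    next
      case False
      then have "A = insert x (insert (f x) B)" "{z\<in>A. f z = z} = {z\<in>B. f z = z}" "x \<notin> B" "f x \<notin> B"
        using A fx by auto
      then have "card A = Suc (Suc (card B))" "card {z\<in>A. f z = z} = card {z\<in>B. f z = z}"
        using fB False by simp_all
      then show ?thesis using 1 IH by simp
    qed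
  qed simp
qed

text \<open>The points moved by \<open>f\<close> pair off. For a matching this ties the parity of
  the number of missed vertices to that of the order.\<close>

corollary even_card_involution:
  assumes "finite A" "f ` A \<subseteq> A" "\<And>x. x \<in> A \<Longrightarrow> f (f x) = x"
  shows "even (card A + card {x\<in>A. f x = x})"
  by (subst card_involution_orbits[OF assms, symmetric]) simp_all

subsection \<open>Small Ramsey numbers\<close>

locale adjacency =
  fixes E :: "'a \<Rightarrow> 'a \<Rightarrow> bool"
  assumes sym: "E x y \<Longrightarrow> E y x" and irrefl: "\<not> E x x"
begin

definition indep :: "'a set \<Rightarrow> bool" where
  "indep S \<longleftrightarrow> (\<forall>x\<in>S. \<forall>y\<in>S. \<not> E x y)"

definition indep_le :: "'a set \<Rightarrow> nat \<Rightarrow> bool" where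
  "indep_le A n \<longleftrightarrow> (\<forall>S\<subseteq>A. indep S \<longrightarrow> card S \<le> n)"

definition triangle_free :: "'a set \<Rightarrow> bool" where
  "triangle_free A \<longleftrightarrow> (\<forall>x\<in>A. \<forall>y\<in>A. \<forall>z\<in>A. \<not> (E x y \<and> E y z \<and> E x z))"

definition nbs :: "'a set \<Rightarrow> 'a \<Rightarrow> 'a set" where
  "nbs A v = {u\<in>A. E v u}"

definition non_nbs :: "'a set \<Rightarrow> 'a \<Rightarrow> 'a set" where
  "non_nbs A v = {u\<in>A. u \<noteq> v \<and> \<not> E v u}"

definition C5 :: "'a \<Rightarrow> 'a \<Rightarrow> 'a \<Rightarrow> 'a \<Rightarrow> 'a \<Rightarrow> bool" where
  "C5 p q r s t \<longleftrightarrow> distinct [p, q, r, s, t] \<and> E p q \<and> E q r \<and> E r s \<and> E s t \<and> E t p \<and>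
     \<not> E p r \<and> \<not> E q s \<and> \<not> E r t \<and> \<not> E s p \<and> \<not> E t q"

lemma E_sym: "E x y \<longleftrightarrow> E y x"
  using sym by blast

lemma E_neq: "E x y \<Longrightarrow> x \<noteq> y"
  using irrefl by blast

lemma indepD: "indep S \<Longrightarrow> x \<in> S \<Longrightarrow> y \<in> S \<Longrightarrow> \<not> E x y"
  unfolding indep_def by blast

lemma indep_leD: "indep_le A n \<Longrightarrow> S \<subseteq> A \<Longrightarrow> indep S \<Longrightarrow> card S \<le> n"
  unfolding indep_le_def by blast

lemma triangle_freeD:
  "triangle_free A \<Longrightarrow> x \<in> A \<Longrightarrow> y \<in> A \<Longrightarrow> z \<in> A \<Longrightarrow> E x y \<Longrightarrow> E y z \<Longrightarrow> \<not> E x z"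
  unfolding triangle_free_def by blast

lemma triangle_free_subset: "triangle_free A \<Longrightarrow> B \<subseteq> A \<Longrightarrow> triangle_free B"
  unfolding triangle_free_def by blast

lemma nbs_subset: "nbs A v \<subseteq> A" and non_nbs_subset: "non_nbs A v \<subseteq> A"
  by (auto simp: nbs_def non_nbs_def)

lemma mem_nbs: "u \<in> nbs A v \<longleftrightarrow> u \<in> A \<and> E v u"
  by (auto simp: nbs_def)

lemma finite_nbs [simp]: "finite A \<Longrightarrow> finite (nbs A v)"
  and finite_non_nbs [simp]: "finite A \<Longrightarrow> finite (non_nbs A v)"
  by (auto simp: nbs_def non_nbs_def)

lemma indep_nbs: "triangle_free A \<Longrightarrow> v \<in> A \<Longrightarrow> indep (nbs A v)"
  unfolding triangle_free_def indep_def nbs_def by (metis (no_types, lifting) mem_Collect_eq)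

lemma card_nbs_le: "triangle_free A \<Longrightarrow> indep_le A n \<Longrightarrow> v \<in> A \<Longrightarrow> card (nbs A v) \<le> n"
  using indep_leD[OF _ nbs_subset indep_nbs] .

lemma card_split_nbs:
  assumes "finite A" "v \<in> A"
  shows "card A = Suc (card (nbs A v) + card (non_nbs A v))"
proof -
  have "A = insert v (nbs A v \<union> non_nbs A v)" and "v \<notin> nbs A v \<union> non_nbs A v"
    and "nbs A v \<inter> non_nbs A v = {}"
    using assms irrefl by (auto simp: nbs_def non_nbs_def)
  then show ?thesis using assms(1)
    by (metis card_Un_disjoint card_insert_disjoint finite_nbs finite_non_nbs finite_UnI)
qed

text \<open>Adding \<open>v\<close> to an independent set of its non-neighbours keeps it
  independent. This is the recursion step of all the Ramsey bounds: the neighbours of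
  \<open>v\<close> form an independent set, and the non-neighbours satisfy the bound lowered by
  one.\<close>

lemma indep_le_non_nbs:
  assumes "finite A" "v \<in> A" "indep_le A (Suc n)"
  shows "indep_le (non_nbs A v) n"
  unfolding indep_le_def
proof (intro allI impI)
  fix S assume S: "S \<subseteq> non_nbs A v" "indep S"
  then have fin: "finite S" and v: "v \<notin> S" using assms(1) finite_subset
    by (auto simp: non_nbs_def intro: finite_subset[OF S(1)])
  have "indep (insert v S)" using S irrefl sym unfolding indep_def non_nbs_def by auto
  moreover have "insert v S \<subseteq> A" using S assms(2) non_nbs_subset by blast
  ultimately have "card (insert v S) \<le> Suc n" using assms(3) indep_leD by blast
  then show "card S \<le> n" using fin v by simp
qed

lemma indep_empty: "indep {}" and indep_singleton: "indep {x}"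
  by (auto simp: indep_def irrefl)

lemma indep_le_0: "finite A \<Longrightarrow> indep_le A 0 \<Longrightarrow> A = {}"
  using indep_leD[OF _ _ indep_singleton, of A 0] by (metis card_1_singleton_iff ex_in_conv insert_subset
    empty_subsetI One_nat_def not_one_le_zero)

lemma card_le_of_indep_le_1:
  assumes "finite A" "triangle_free A" "indep_le A 1"
  shows "card A \<le> 2"
proof (cases "A = {}")
  case False
  then obtain v where v: "v \<in> A" by blast
  have "non_nbs A v = {}"
    using indep_le_0[of "non_nbs A v"] indep_le_non_nbs[of A v 0] assms v by auto
  then show ?thesis using card_split_nbs[OF assms(1) v] card_nbs_le[OF assms(2,3) v] by simp
qed simp

text \<open>R(3,3) \<le> 6: a vertex, at most 2 neighbours and at most 2 non-neighbours.\<close>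

lemma card_le_of_indep_le_2:
  assumes "finite A" "triangle_free A" "indep_le A 2"
  shows "card A \<le> 5"
proof (cases "A = {}")
  case False
  then obtain v where v: "v \<in> A" by blast
  have "card (non_nbs A v) \<le> 2"
    using card_le_of_indep_le_1[of "non_nbs A v"] indep_le_non_nbs[of A v 1] assms v
      triangle_free_subset[OF assms(2) non_nbs_subset] by (auto simp: numeral_2_eq_2)
  then show ?thesis using card_split_nbs[OF assms(1) v] card_nbs_le[OF assms(2,3) v] by simp
qed simp

text \<open>The handshake lemma: a new vertex raises the degree of each of its neighbours by one,
  and its own degree contributes the same amount again.\<close>

lemma even_sum_card_nbs:
  assumes "finite A"
  shows "even (\<Sum>v\<in>A. card (nbs A v))"
  using assms
proof induction
  case (insert x A)
  have *: "card (nbs (insert x A) v) = card (nbs A v) + (if E v x then 1 else 0)" if "v \<in> A" for v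
  proof -
    have "nbs (insert x A) v = (if E v x then insert x (nbs A v) else nbs A v)"
      by (auto simp: nbs_def)
    moreover have "x \<notin> nbs A v" using insert by (auto simp: nbs_def)
    ultimately show ?thesis using insert by simp
  qed
  have "nbs (insert x A) x = nbs A x" using irrefl by (auto simp: nbs_def)
  moreover have "(\<Sum>v\<in>A. if E v x then 1 else 0) = card (nbs A x)"
    using insert by (simp add: sum.If_cases nbs_def Int_def E_sym)
  ultimately have "(\<Sum>v\<in>insert x A. card (nbs (insert x A) v))
      = card (nbs A x) + ((\<Sum>v\<in>A. card (nbs A v)) + card (nbs A x))"
    using insert by (simp add: * sum.distrib)
  then show ?case using insert by simp
qed simp

text \<open>R(3,4) \<le> 9. The plain recursion gives 1 + 3 + 5 = 9; if that were attained, the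
  graph would be 3-regular on 9 vertices, with odd degree sum 27.\<close>

lemma card_le_of_indep_le_3:
  assumes "finite A" "triangle_free A" "indep_le A 3"
  shows "card A \<le> 8"
proof (rule ccontr)
  assume "\<not> ?thesis"
  then have ge: "card A \<ge> 9" by simp
  have "card (nbs A v) = 3 \<and> card A = 9" if v: "v \<in> A" for v
  proof -
    have "card (non_nbs A v) \<le> 5"
      using card_le_of_indep_le_2[of "non_nbs A v"] indep_le_non_nbs[of A v 2] assms v
        triangle_free_subset[OF assms(2) non_nbs_subset] by (auto simp: eval_nat_numeral)
    then show ?thesis using card_split_nbs[OF assms(1) v] card_nbs_le[OF assms(2,3) v] ge by simp
  qed
  moreover obtain v where "v \<in> A" using ge by fastforce
  ultimately have "(\<Sum>v\<in>A. card (nbs A v)) = 27" by simp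
  then show False using even_sum_card_nbs[OF assms(1)] by simp
qed

text \<open>On 5 vertices the count 1 + 2 + 2 is tight, so every vertex has exactly two neighbours.
  The two non-neighbours of \<open>p\<close> are adjacent, since otherwise they and \<open>p\<close>
  would be independent; each of them has room for one more neighbour, so the two neighbours of
  \<open>p\<close> attach to different ones.\<close>

lemma C5_of_indep_le_2:
  assumes fin: "finite A" and tf: "triangle_free A" and al: "indep_le A 2" and c: "card A = 5"
    and p: "p \<in> A"
  obtains q r s t where "A = {p, q, r, s, t}" "C5 p q r s t"
proof -
  have deg: "card (nbs A v) = 2 \<and> card (non_nbs A v) = 2 \<and> indep_le (non_nbs A v) 1"
    if v: "v \<in> A" for v
  proof -
    have "indep_le (non_nbs A v) 1"
      using indep_le_non_nbs[of A v 1] assms v by (auto simp: eval_nat_numeral)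
    moreover from this have "card (non_nbs A v) \<le> 2"
      using card_le_of_indep_le_1[of "non_nbs A v"] fin
        triangle_free_subset[OF tf non_nbs_subset] by auto
    ultimately show ?thesis using card_split_nbs[OF fin v] card_nbs_le[OF tf al v] c by simp
  qed
  have no3: False if "x \<in> A" "y \<in> A" "z \<in> A" "distinct [x, y, z]" "\<not> E x y" "\<not> E y z" "\<not> E x z" for x y z
    using indep_leD[OF al, of "{x,y,z}"] that by (auto simp: indep_def irrefl E_sym)
  have deg3: False if "x \<in> A" "y \<in> A" "z \<in> A" "v \<in> A" "distinct [x, y, z]" "E v x" "E v y" "E v z" for v x y z
  proof -
    have "{x,y,z} \<subseteq> nbs A v" using that by (auto simp: nbs_def)
    then have "card {x,y,z} \<le> card (nbs A v)" using fin by (intro card_mono) auto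
    then show False using deg[of v] that by simp
  qed
  have tri: "\<not> E y z" if "x \<in> A" "y \<in> A" "z \<in> A" "E x y" "E x z" for x y z
    using triangle_freeD[OF tf, of y x z] that sym by blast
  obtain q t where qt: "nbs A p = {q, t}" "q \<noteq> t" using deg[OF p] by (auto simp: card_2_iff)
  obtain r s where rs: "non_nbs A p = {r, s}" "r \<noteq> s" using deg[OF p] by (auto simp: card_2_iff)
  have A: "A = {p, q, t, r, s}"
    using qt rs p unfolding nbs_def non_nbs_def by blast
  have d: "distinct [p, q, t, r, s]" using c A card_distinct[of "[p,q,t,r,s]"] by simp
  have e: "E p q" "E p t" "\<not> E p r" "\<not> E p s"
    using qt rs by (auto simp: nbs_def non_nbs_def)
  have "E r s" using no3[of p r s] e d A by auto
  have "\<not> E q t" using tri[of p q t] e A by auto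
  have q2: "E q r \<or> E q s"
  proof (rule ccontr)
    assume "\<not> ?thesis"
    then have "nbs A q \<subseteq> {p}" using A \<open>\<not> E q t\<close> irrefl by (auto simp: nbs_def)
    then have "card (nbs A q) \<le> 1" using card_mono[of "{p}"] by fastforce
    then show False using deg[of q] A by simp
  qed
  have t2: "E t r \<or> E t s"
  proof (rule ccontr)
    assume "\<not> ?thesis"
    then have "nbs A t \<subseteq> {p}" using A \<open>\<not> E q t\<close> irrefl E_sym by (auto simp: nbs_def)
    then have "card (nbs A t) \<le> 1" using card_mono[of "{p}"] by fastforce
    then show False using deg[of t] A by simp
  qed
  show thesis
  proof (cases "E q r")
    case True
    then have 1: "\<not> E q s" using tri[of r q s] \<open>E r s\<close> A E_sym by auto
    have 2: "\<not> E t r" using deg3[of q t s r] True \<open>E r s\<close> A d E_sym by auto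
    with t2 have "E t s" by blast
    with True 1 2 d e \<open>E r s\<close> \<open>\<not> E q t\<close> have "C5 p q r s t"
      unfolding C5_def using E_sym by auto
    then show thesis using that A by (metis insert_commute)
  next
    case False
    then have T: "E q s" using q2 by blast
    then have 2: "\<not> E t s" using deg3[of q t r s] \<open>E r s\<close> A d E_sym by auto
    with t2 have "E t r" by blast
    with T False 2 d e \<open>E r s\<close> \<open>\<not> E q t\<close> have "C5 p q s r t"
      unfolding C5_def using E_sym by auto
    then show thesis using that A by (metis insert_commute)
  qed
qed

subsection \<open>Triangle-free graphs on 13 vertices without independent 5-sets\<close>

lemma nbs_Un: "nbs (A \<union> B) v = nbs A v \<union> nbs B v"
  by (auto simp: nbs_def)

lemma card_nbs_Un:
  "finite A \<Longrightarrow> finite B \<Longrightarrow> A \<inter> B = {} \<Longrightarrow> card (nbs (A \<union> B) v) = card (nbs A v) + card (nbs B v)"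
  unfolding nbs_Un by (subst card_Un_disjoint) (auto simp: nbs_def)

text \<open>Double counting of the adjacent pairs in \<open>A\<close> \<times>
  \<open>B\<close>.\<close>

lemma sum_card_nbs_swap:
  assumes "finite A" "finite B"
  shows "(\<Sum>u\<in>A. card (nbs B u)) = (\<Sum>v\<in>B. card (nbs A v))"
proof -
  have c: "card (nbs C u) = (\<Sum>v\<in>C. if E u v then 1 else 0)"
    and c': "card (nbs C u) = (\<Sum>v\<in>C. if E v u then 1 else 0)" if "finite C" for C u
    using that unfolding nbs_def by (simp_all add: sum.inter_filter[symmetric] E_sym[of u])
  show ?thesis unfolding c[OF assms(2)] c'[OF assms(1)] by (rule sum.swap)
qed

lemma sum_card_nbs_Un:
  assumes "finite A" "finite B" "A \<inter> B = {}"
  shows "(\<Sum>v\<in>A \<union> B. card (nbs (A \<union> B) v)) =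
    (\<Sum>v\<in>A. card (nbs A v)) + (\<Sum>v\<in>B. card (nbs B v)) + 2 * (\<Sum>v\<in>A. card (nbs B v))"
  using sum_card_nbs_swap[OF assms(1,2)]
  by (simp add: sum.union_disjoint[OF assms] card_nbs_Un[OF assms] sum.distrib)

text \<open>The list positions are the residues modulo 13. The offsets 8 and 12 stand for -5 and -1,
  so this is a labelling by the complement of \<open>Q_graph\<close> in natural numbers.\<close>

definition circulant_13_1_5 :: "'a list \<Rightarrow> bool" where
  "circulant_13_1_5 xs \<longleftrightarrow> length xs = 13 \<and> distinct xs \<and>
     (\<forall>i<13. \<forall>j<13. E (xs ! i) (xs ! j) \<longleftrightarrow>
        j \<in> {(i + 1) mod 13, (i + 5) mod 13, (i + 8) mod 13, (i + 12) mod 13})"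

text \<open>Only the edges with offsets 1 and 5 have to be checked: by symmetry they provide the
  offsets 12 and 8, and four neighbours exhaust the degree bound, so every other pair is a
  non-edge.\<close>

lemma circulant_13_1_5I:
  assumes len: "length xs = 13" and d: "distinct xs"
    and deg: "\<And>v. v \<in> set xs \<Longrightarrow> card (nbs (set xs) v) \<le> 4"
    and e: "\<And>i. i < 13 \<Longrightarrow> E (xs ! i) (xs ! ((i + 1) mod 13)) \<and> E (xs ! i) (xs ! ((i + 5) mod 13))"
  shows "circulant_13_1_5 xs"
proof -
  have "E (xs ! i) (xs ! j) \<longleftrightarrow> j \<in> {(i + 1) mod 13, (i + 5) mod 13, (i + 8) mod 13, (i + 12) mod 13}"
    if i: "i < 13" and j: "j < 13" for i j
  proof -
    have i': "i \<in> {0, 1, 2, 3, 4, 5, 6, 7, 8, 9, 10, 11, 12}" using i by (simp, presburger)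
    let ?I = "{(i + 1) mod 13, (i + 5) mod 13, (i + 8) mod 13, (i + 12) mod 13}"
    have I: "?I \<subseteq> {..<length xs}" using len by auto
    have "card ?I = 4"
    proof -
      have "distinct [(i + 1) mod 13, (i + 5) mod 13, (i + 8) mod 13, (i + 12) mod 13]"
        using i' by (elim insertE) simp_all
      from distinct_card[OF this] show ?thesis by simp
    qed
    then have c: "card ((!) xs ` ?I) = 4"
      using inj_on_nth[OF d, of ?I] I len by (subst card_image) auto
    have "E (xs ! ((i + 8) mod 13)) (xs ! i)" "E (xs ! ((i + 12) mod 13)) (xs ! i)"
      using e[of "(i + 8) mod 13"] e[of "(i + 12) mod 13"] i by (simp_all add: mod_simps)
    then have "(!) xs ` ?I \<subseteq> nbs (set xs) (xs ! i)"
      using e[OF i] sym len by (auto simp: nbs_def)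
    then have "(!) xs ` ?I = nbs (set xs) (xs ! i)"
      using deg[of "xs ! i"] c i len by (intro card_seteq) auto
    then have "E (xs ! i) (xs ! j) \<longleftrightarrow> xs ! j \<in> (!) xs ` ?I"
      using j len by (auto simp: nbs_def)
    also have "\<dots> \<longleftrightarrow> j \<in> ?I"
      using inj_on_image_mem_iff[OF inj_on_nth[OF d, of "{..<length xs}"], of j ?I] I j len by simp
    finally show ?thesis .
  qed
  then show ?thesis using len d by (simp add: circulant_13_1_5_def)
qed

text \<open>The result is a 4-cycle \<open>y c0 c1 c2\<close> whose opposite vertices are joined by the paths
  \<open>y w x c1\<close> and \<open>c0 c4 c3 c2\<close>.\<close>

lemma eight_vertices_structure:
  assumes fin: "finite B" and c: "card B = 8" and tf: "triangle_free B" and al: "indep_le B 3"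
    and sum: "(\<Sum>v\<in>B. card (nbs B v)) = 20"
  obtains w x y c0 c1 c2 c3 c4 where "B = {w, x, y, c0, c1, c2, c3, c4}"
    "nbs B w = {x, y}" "nbs B x = {w, c1}" "nbs B y = {w, c0, c2}"
    "nbs B c0 = {y, c1, c4}" "nbs B c1 = {x, c0, c2}" "nbs B c2 = {y, c1, c3}"
    "nbs B c3 = {c2, c4}" "nbs B c4 = {c0, c3}"
proof -
  have deg: "2 \<le> card (nbs B v) \<and> card (nbs B v) \<le> 3" and non: "indep_le (non_nbs B v) 2"
    if "v \<in> B" for v
  proof -
    show *: "indep_le (non_nbs B v) 2"
      using indep_le_non_nbs[of B v 2] fin al that by (simp add: eval_nat_numeral)
    have "card (non_nbs B v) \<le> 5"
      using card_le_of_indep_le_2[OF _ triangle_free_subset[OF tf non_nbs_subset] *] fin by simp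
    then show "2 \<le> card (nbs B v) \<and> card (nbs B v) \<le> 3"
      using card_split_nbs[OF fin that] card_nbs_le[OF tf al that] c by simp
  qed
  have "\<exists>w\<in>B. card (nbs B w) = 2"
  proof (rule ccontr)
    assume "\<not> ?thesis"
    then have "\<forall>v\<in>B. card (nbs B v) = 3" using deg by (metis le_antisym not_less_eq_eq eval_nat_numeral(3))
    then show False using sum c by simp
  qed
  then obtain w0 where w0: "w0 \<in> B" "card (nbs B w0) = 2" by blast
  have tri: "\<not> E y z" if "x \<in> B" "y \<in> B" "z \<in> B" "E x y" "E x z" for x y z
    using triangle_freeD[OF tf, of y x z] that sym by blast
  \<comment> \<open>Removing a vertex of degree 2 with its neighbours leaves 5 vertices without
    independent 3-sets, hence an induced 5-cycle.\<close>
  have five: "\<exists>q r s t. B - {w, x, y} = {p, q, r, s, t} \<and> C5 p q r s t"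
    if "w \<in> B" "nbs B w = {x, y}" "x \<noteq> y" "p \<in> B - {w, x, y}" for w x y p
  proof -
    have C: "B - {w, x, y} = non_nbs B w"
      using that(2) by (auto simp: nbs_def non_nbs_def)
    have "card (non_nbs B w) = 5" using card_split_nbs[OF fin that(1)] that c by simp
    then show ?thesis
      using C5_of_indep_le_2[OF _ triangle_free_subset[OF tf non_nbs_subset] non[OF that(1)], of p]
        fin that(4) unfolding C by (metis finite_non_nbs)
  qed
  have split: "card (nbs B x) = Suc (card (nbs (B - {w, x, y}) x)) \<and>
       card (nbs B y) = Suc (card (nbs (B - {w, x, y}) y)) \<and> card (nbs B x) + card (nbs B y) = 5"
    if w: "w \<in> B" "nbs B w = {x, y}" "x \<noteq> y" for w x y
  proof -
    let ?C = "B - {w, x, y}"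
    have xy: "x \<in> B" "y \<in> B" "E w x" "E w y" using w by (auto simp: nbs_def)
    then have ne: "w \<noteq> x" "w \<noteq> y" using E_neq by blast+
    have nxy: "\<not> E x y" using tri xy w by blast
    have D: "nbs {w, x, y} w = {x, y}" "nbs {w, x, y} x = {w}" "nbs {w, x, y} y = {w}"
      using nxy xy sym irrefl by (auto simp: nbs_def)
    have B: "B = {w, x, y} \<union> ?C" using w xy by blast
    have "card ?C = 5" using c w xy ne fin by (simp add: card_Diff_subset)
    then have "?C \<noteq> {}" by force
    then obtain p where p: "p \<in> ?C" by blast
    have reg: "card (nbs ?C u) = 2" if u: "u \<in> ?C" for u
    proof -
      obtain q r s t where C: "?C = {u, q, r, s, t}" and C5: "C5 u q r s t"
        using five[OF w u] by blast
      have "nbs ?C u = {q, t}" using C5 irrefl E_sym unfolding C nbs_def C5_def by auto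
      then show ?thesis using C5 by (simp add: C5_def)
    qed
    have nC: "nbs ?C w = {}" using w(2) by (auto simp: nbs_def)
    \<comment> \<open>4 is the degree sum of the path \<open>x w y\<close> and 10 that of the
      5-cycle, so exactly 3 edges run from \<open>x\<close> and \<open>y\<close> to the cycle; with
      the two edges at \<open>w\<close> the degrees of \<open>x\<close> and \<open>y\<close> add up
      to 5.\<close>
    have "20 = 4 + 10 + 2 * (card (nbs ?C x) + card (nbs ?C y))"
      using sum_card_nbs_Un[of "{w, x, y}" ?C] fin sum B reg \<open>card ?C = 5\<close> ne w(3) D nC by simp
    moreover have "card (nbs B x) = 1 + card (nbs ?C x)" "card (nbs B y) = 1 + card (nbs ?C y)"
      using card_nbs_Un[of "{w, x, y}" ?C] fin D unfolding B[symmetric] by simp_all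
    ultimately show ?thesis by simp
  qed
  obtain w x y where w: "w \<in> B" "nbs B w = {x, y}" "x \<noteq> y" and dx: "card (nbs B x) = 2"
    and dy: "card (nbs B y) = 3"
  proof -
    obtain a b where ab: "nbs B w0 = {a, b}" "a \<noteq> b" using w0 by (auto simp: card_2_iff)
    then have "a \<in> B" "b \<in> B" by (auto simp: nbs_def)
    moreover have "card (nbs B a) + card (nbs B b) = 5" using split w0 ab by blast
    ultimately have "card (nbs B a) = 2 \<and> card (nbs B b) = 3 \<or> card (nbs B b) = 2 \<and> card (nbs B a) = 3"
      using deg[of a] deg[of b] by linarith
    then show thesis using that[of w0 a b] that[of w0 b a] w0 ab by (auto simp: insert_commute)
  qed
  let ?C = "B - {w, x, y}"
  have xy: "x \<in> B" "y \<in> B" "E w x" "E w y" "w \<noteq> x" "w \<noteq> y" "\<not> E x y"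
    using w tri[of w x y] irrefl by (auto simp: nbs_def)
  have "card (nbs ?C x) = 1" using split[OF w] dx by simp
  then obtain p where p: "nbs ?C x = {p}" by (rule card_1_singletonE)
  then have pC: "p \<in> ?C" "E x p" by (auto simp: nbs_def)
  obtain q r s t where C: "?C = {p, q, r, s, t}" and C5: "C5 p q r s t"
    using five[OF w pC(1)] by blast
  have "B = {w, x, y} \<union> ?C" using w(1) xy(1,2) by blast
  then have B: "B = {w, x, y, p, q, r, s, t}" unfolding C by (simp only: Un_insert_left Un_empty_left)
  have d: "distinct [w, x, y, p, q, r, s, t]"
    by (rule card_distinct) (use B c in \<open>simp only: list.set, simp\<close>)
  have memC: "q \<in> ?C" "r \<in> ?C" "s \<in> ?C" "t \<in> ?C" unfolding C by simp_all
  have xn: "\<not> E x q" "\<not> E x r" "\<not> E x s" "\<not> E x t" and wn: "\<not> E w p" "\<not> E w q" "\<not> E w r" "\<not> E w s" "\<not> E w t"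
  proof -
    have x: "\<not> E x u" if "u \<in> ?C" "u \<noteq> p" for u using p that mem_nbs[of u ?C x] by simp
    have w: "\<not> E w u" if "u \<in> ?C" for u using w(2) that mem_nbs[of u B w] by auto
    show "\<not> E x q" "\<not> E x r" "\<not> E x s" "\<not> E x t"
      using d x[OF memC(1)] x[OF memC(2)] x[OF memC(3)] x[OF memC(4)] by auto
    show "\<not> E w p" "\<not> E w q" "\<not> E w r" "\<not> E w s" "\<not> E w t" by (intro w memC pC(1))+
  qed
  have e: "E p q" "E q r" "E r s" "E s t" "E t p" "\<not> E p r" "\<not> E q s" "\<not> E r t" "\<not> E s p" "\<not> E t q"
    using C5 by (auto simp: C5_def)
  have mem: "w \<in> B" "x \<in> B" "y \<in> B" "p \<in> B" "q \<in> B" "r \<in> B" "s \<in> B" "t \<in> B"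
    unfolding B by simp_all
  \<comment> \<open>Otherwise \<open>q\<close>, \<open>t\<close>, \<open>x\<close> and
    \<open>y\<close> would be four neighbours of \<open>p\<close>, while degrees are at most
    3.\<close>
  have "\<not> E y p"
  proof
    assume "E y p"
    then have "{q, t, x, y} \<subseteq> nbs B p" using e pC(2) mem sym by (auto simp: mem_nbs)
    then have "card {q, t, x, y} \<le> card (nbs B p)" using fin by (intro card_mono) auto
    then show False using deg[of p] pC d by auto
  qed
  have sym': "E u v = E v u" for u v by (rule E_sym)
  have cm: "card S \<le> card (nbs B u)" if "S \<subseteq> nbs B u" for S u
    using that fin by (simp add: card_mono)
  have y2: "card (nbs ?C y) = 2" using split[OF w] dy by simp
  \<comment> \<open>Otherwise \<open>r\<close> would have degree 2 and both its neighbours degree at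
    least 3, contrary to the sum 5 in \<open>split\<close>. The pair \<open>r\<close>,
    \<open>t\<close> fails in the same way through \<open>s\<close>, and consecutive pairs of the
    cycle would give triangles, so \<open>q\<close>, \<open>t\<close> is the only pair left.\<close>
  have "\<not> (E y q \<and> E y s)"
  proof
    assume a: "E y q \<and> E y s"
    have "\<not> E y r" using tri[of y q r] a e mem by blast
    then have "nbs B r = {q, s}" using e xn wn B irrefl sym' by (auto simp: nbs_def)
    moreover have "{p, r, y} \<subseteq> nbs B q" "{r, t, y} \<subseteq> nbs B s" using a e mem sym by (auto simp: mem_nbs)
    then have "card {p, r, y} \<le> card (nbs B q)" "card {r, t, y} \<le> card (nbs B s)"
      by (simp_all only: cm)
    moreover have "card {p, r, y} = 3" "card {r, t, y} = 3" "q \<noteq> s" using d by auto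
    ultimately show False using split[OF mem(6), of q s] by simp
  qed
  moreover have "\<not> (E y r \<and> E y t)"
  proof
    assume a: "E y r \<and> E y t"
    have "\<not> E y s" using tri[of y r s] a e mem by blast
    then have "nbs B s = {r, t}" using e xn wn B irrefl sym' by (auto simp: nbs_def)
    moreover have "{q, s, y} \<subseteq> nbs B r" "{p, s, y} \<subseteq> nbs B t" using a e mem sym by (auto simp: mem_nbs)
    then have "card {q, s, y} \<le> card (nbs B r)" "card {p, s, y} \<le> card (nbs B t)"
      by (simp_all only: cm)
    moreover have "card {q, s, y} = 3" "card {p, s, y} = 3" "r \<noteq> t" using d by auto
    ultimately show False using split[OF mem(7), of r t] by simp
  qed
  moreover have "\<not> (E y q \<and> E y r)" "\<not> (E y r \<and> E y s)" "\<not> (E y s \<and> E y t)"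
    using tri[of y] e mem by simp_all blast+
  moreover have "\<exists>a b. a \<noteq> b \<and> nbs ?C y = {a, b}"
    using y2 unfolding card_2_iff by blast
  then obtain a b where ab: "a \<noteq> b" "nbs ?C y = {a, b}" by blast
  then have "E y a" "E y b" "a \<in> ?C" "b \<in> ?C" by (auto simp: nbs_def)
  moreover from this have "a \<in> {p, q, r, s, t}" "b \<in> {p, q, r, s, t}" by (simp_all only: C)
  ultimately have "{a, b} = {q, t}" using \<open>\<not> E y p\<close> ab(1) by auto
  then have yC: "nbs ?C y = {q, t}" using ab by simp
  have yn: "E y q" "E y t" "\<not> E y r" "\<not> E y s"
  proof -
    have y: "E y u \<longleftrightarrow> u = q \<or> u = t" if "u \<in> ?C" for u using yC that mem_nbs[of u ?C y] by simp
    show "E y q" "E y t" "\<not> E y r" "\<not> E y s" using d by (auto simp only: y[OF memC(1)] y[OF memC(2)] y[OF memC(3)] y[OF memC(4)] distinct.simps list.set)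
  qed
  note all = e xn wn yn \<open>\<not> E y p\<close> pC(2) xy(3,4,7)
  show thesis
  proof (rule that[of w x y q p t s r])
    show "B = {w, x, y, q, p, t, s, r}" using B by blast
    show "nbs B w = {x, y}" by (fact w(2))
    show "nbs B x = {w, p}" "nbs B y = {w, q, t}" "nbs B q = {y, p, r}" "nbs B p = {x, q, t}"
      "nbs B t = {y, p, s}" "nbs B s = {t, r}" "nbs B r = {q, s}"
      unfolding B nbs_def using all irrefl sym' by auto
  qed
qed

text \<open>For a vertex \<open>v\<close>, the eight non-neighbours induce the graph above.  Each of the four neighbours of
  \<open>v\<close> is adjacent to one of \<open>w, x\<close>, one of \<open>c3, c4\<close> (all four combinations occur) and one vertex of the
  4-cycle.  Only two choices of the latter remain; the symmetry exchanging \<open>w, x\<close> and \<open>y, c1\<close> swaps them.\<close>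

lemma circulant_of_indep_le_4:
  assumes fin: "finite A" and tf: "triangle_free A" and al: "indep_le A 4" and c: "card A = 13"
  obtains xs where "set xs = A" "circulant_13_1_5 xs"
proof -
  note conclude = that
  have deg: "card (nbs A v) = 4" and non: "card (non_nbs A v) = 8" "indep_le (non_nbs A v) 3"
    if v: "v \<in> A" for v
  proof -
    show *: "indep_le (non_nbs A v) 3"
      using indep_le_non_nbs[of A v 3] fin al v by (simp add: eval_nat_numeral)
    have "card (non_nbs A v) \<le> 8"
      using card_le_of_indep_le_3[OF _ triangle_free_subset[OF tf non_nbs_subset] *] fin by simp
    then show "card (nbs A v) = 4" "card (non_nbs A v) = 8"
      using card_split_nbs[OF fin v] card_nbs_le[OF tf al v] c by simp_all
  qed
  have tri: "\<not> E y z" if "x \<in> A" "y \<in> A" "z \<in> A" "E x y" "E x z" for x y z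
    using triangle_freeD[OF tf, of y x z] that sym by blast
  obtain v where v: "v \<in> A" using c by fastforce
  define N where "N = nbs A v"
  define B where "B = non_nbs A v"
  have finNB: "finite N" "finite B" and subs: "N \<subseteq> A" "B \<subseteq> A" and vN: "v \<notin> N" "v \<notin> B"
    using fin irrefl by (auto simp: N_def B_def nbs_def non_nbs_def)
  have cN: "card N = 4" and cB: "card B = 8" using deg non v by (simp_all add: N_def B_def)
  have A: "A = insert v N \<union> B" and disj: "insert v N \<inter> B = {}"
    using v irrefl by (auto simp: N_def B_def nbs_def non_nbs_def)
  have vadj: "E v a" if "a \<in> N" for a using that by (simp add: N_def nbs_def)
  have vnadj: "\<not> E v b" if "b \<in> B" for b using that by (simp add: B_def non_nbs_def)
  have Nindep: "\<not> E a b" if "a \<in> N" "b \<in> N" for a b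
    using tri[of v a b] that v subs vadj by blast
  have degN: "nbs (insert v N) a = {v}" "card (nbs B a) = 3" if a: "a \<in> N" for a
  proof -
    show 1: "nbs (insert v N) a = {v}"
      using a vadj[THEN sym] Nindep by (auto simp: nbs_def)
    then show "card (nbs B a) = 3"
      using card_nbs_Un[OF _ finNB(2) disj, of a] finNB A deg[of a] a subs by auto
  qed
  have degv: "nbs (insert v N) v = N" "nbs B v = {}"
    using vadj vnadj irrefl by (auto simp: nbs_def)
  have "(\<Sum>u\<in>insert v N. card (nbs (insert v N) u)) = 8"
    using finNB vN degN cN by (simp add: degv)
  moreover have "(\<Sum>u\<in>insert v N. card (nbs B u)) = 12"
    using finNB vN degN cN by (simp add: degv)
  moreover have "(\<Sum>u\<in>A. card (nbs A u)) = 52" using deg c by simp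
  \<comment> \<open>52 = 8 + 20 + 2 * 12: the star at \<open>v\<close>, the non-neighbours, and the
    12 edges between neighbours and non-neighbours of \<open>v\<close> counted twice.\<close>
  ultimately have sum: "(\<Sum>u\<in>B. card (nbs B u)) = 20"
    using sum_card_nbs_Un[OF _ finNB(2) disj] finNB unfolding A[symmetric] by simp
  have tfB: "triangle_free B" using triangle_free_subset tf subs by blast
  have alB: "indep_le B 3" using non v by (simp add: B_def)
  obtain w x y c0 c1 c2 c3 c4 where B: "B = {w, x, y, c0, c1, c2, c3, c4}" and
    nbB: "nbs B w = {x, y}" "nbs B x = {w, c1}" "nbs B y = {w, c0, c2}"
    "nbs B c0 = {y, c1, c4}" "nbs B c1 = {x, c0, c2}" "nbs B c2 = {y, c1, c3}"
    "nbs B c3 = {c2, c4}" "nbs B c4 = {c0, c3}"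
    by (rule eight_vertices_structure[OF finNB(2) cB tfB alB sum])
  have dB: "distinct [w, x, y, c0, c1, c2, c3, c4]"
    by (rule card_distinct) (use B cB in \<open>simp only: list.set, simp\<close>)
  have memB: "w \<in> B" "x \<in> B" "y \<in> B" "c0 \<in> B" "c1 \<in> B" "c2 \<in> B" "c3 \<in> B" "c4 \<in> B"
    using B by simp_all
  have eB: "E w x" "E w y" "E x c1" "E y c0" "E y c2" "E c0 c1" "E c0 c4" "E c1 c2" "E c2 c3" "E c3 c4"
    using nbB by (auto simp: nbs_def)
  have degB: "card (nbs B u) + card (nbs N u) = 4" if u: "u \<in> B" for u
  proof -
    have "nbs (insert v N) u = nbs N u" using vnadj[OF u] sym by (auto simp: nbs_def)
    then show ?thesis
      using card_nbs_Un[OF _ finNB(2) disj, of u] finNB A deg[of u] u subs by auto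
  qed
  have cn: "card (nbs N w) = 2" "card (nbs N x) = 2" "card (nbs N c3) = 2" "card (nbs N c4) = 2"
    "card (nbs N y) = 1" "card (nbs N c0) = 1" "card (nbs N c1) = 1" "card (nbs N c2) = 1"
    using degB[of w] degB[of x] degB[of c3] degB[of c4] degB[of y] degB[of c0] degB[of c1] degB[of c2]
      nbB memB dB by simp_all
  \<comment> \<open>Among the 8 non-neighbours of \<open>a\<close>, the vertex \<open>b\<close> has
    degree at least 8 - 1 - 5 = 2; but \<open>v\<close>, \<open>u\<close> and \<open>u'\<close>
    would be three of its four neighbours lying outside that set.\<close>
  have codeg: False if "a \<in> N" "b \<in> N" "a \<noteq> b" "u \<in> B" "u' \<in> B" "u \<noteq> u'"
    "E a u" "E a u'" "E b u" "E b u'" for a b u u'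
  proof -
    have b: "b \<in> non_nbs A a" using that Nindep subs by (auto simp: non_nbs_def)
    have a: "a \<in> A" using that subs by blast
    have "indep_le (non_nbs (non_nbs A a) b) 2"
      using indep_le_non_nbs[OF _ b, of 2] non(2)[OF a] fin by (simp add: eval_nat_numeral)
    moreover have "triangle_free (non_nbs (non_nbs A a) b)"
      by (rule triangle_free_subset[OF tf]) (auto simp: non_nbs_def)
    ultimately have "card (non_nbs (non_nbs A a) b) \<le> 5"
      using card_le_of_indep_le_2 fin by simp
    then have "card (nbs (non_nbs A a) b) \<ge> 2"
      using card_split_nbs[of "non_nbs A a" b] non[of a] that subs fin b by auto
    moreover have "{v, u, u'} \<subseteq> nbs A b - nbs (non_nbs A a) b"
      using that vadj[THEN sym] subs v by (auto simp: nbs_def non_nbs_def)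
    then have "card {v, u, u'} \<le> card (nbs A b - nbs (non_nbs A a) b)"
      using fin by (intro card_mono) auto
    moreover have "nbs (non_nbs A a) b \<subseteq> nbs A b" by (auto simp: nbs_def non_nbs_def)
    then have "card (nbs A b - nbs (non_nbs A a) b) = card (nbs A b) - card (nbs (non_nbs A a) b)"
      using fin by (simp add: card_Diff_subset)
    moreover have "v \<noteq> u" "v \<noteq> u'" using that vN by blast+
    then have "card {v, u, u'} = 3" using that by simp
    moreover have "b \<in> A" using that subs by blast
    ultimately show False using deg[of b] by linarith
  qed
  have c34: "N = nbs N c3 \<union> nbs N c4" "nbs N c3 \<inter> nbs N c4 = {}"
  proof -
    show d: "nbs N c3 \<inter> nbs N c4 = {}"
      using tri eB(10) memB subs sym unfolding nbs_def by blast
    show "N = nbs N c3 \<union> nbs N c4"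
      using card_Un_disjoint[OF _ _ d] cn cN finNB
      by (intro card_subset_eq[symmetric]) (auto simp: nbs_def)
  qed
  \<comment> \<open>By \<open>codeg\<close> the two neighbours of \<open>u\<close> in
    \<open>N\<close> cannot both be adjacent to \<open>c3\<close>, nor both to \<open>c4\<close>; as
    \<open>c3\<close> and \<open>c4\<close> split \<open>N\<close> between them, each gets
    one.\<close>
  have pick: "\<exists>a b. nbs N u = {a, b} \<and> a \<noteq> b \<and> E c3 a \<and> E c4 b"
    if u: "u \<in> {w, x}" for u
  proof -
    have "card (nbs N u) = 2" using u cn by auto
    then obtain a b where ab: "nbs N u = {a, b}" "a \<noteq> b" by (auto simp: card_2_iff)
    then have abN: "a \<in> N" "b \<in> N" "E u a" "E u b" by (auto simp: nbs_def)
    have "u \<in> B" "u \<noteq> c3" "u \<noteq> c4" using u memB dB by auto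
    then have "\<not> (E c3 a \<and> E c3 b)" "\<not> (E c4 a \<and> E c4 b)"
      using codeg[of a b u] abN ab(2) memB sym by blast+
    moreover have "E c3 a \<or> E c4 a" "E c3 b \<or> E c4 b"
      using abN c34(1) by (auto simp: nbs_def)
    ultimately show ?thesis using ab by (metis insert_commute)
  qed
  obtain a1 a2 where a12: "nbs N w = {a1, a2}" "a1 \<noteq> a2" "E c3 a1" "E c4 a2" using pick by blast
  obtain a3 a4 where a34: "nbs N x = {a3, a4}" "a3 \<noteq> a4" "E c3 a3" "E c4 a4" using pick by blast
  have dwx: "nbs N w \<inter> nbs N x = {}"
    using tri eB(1) memB subs sym unfolding nbs_def by blast
  have N: "N = {a1, a2, a3, a4}"
  proof -
    have "nbs N w \<union> nbs N x = N"
      using card_Un_disjoint[OF _ _ dwx] cn cN finNB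
      by (intro card_subset_eq) (auto simp: nbs_def)
    then show ?thesis using a12 a34 by auto
  qed
  have ea: "E w a1" "E w a2" "E x a3" "E x a4" using a12 a34 by (auto simp: nbs_def)
  have aN: "a1 \<in> N" "a2 \<in> N" "a3 \<in> N" "a4 \<in> N" using N by auto
  have third: "\<exists>u \<in> B - {p, q}. E u a" if "a \<in> N" for a p q
  proof (rule ccontr)
    assume "\<not> ?thesis"
    then have "nbs B a \<subseteq> {p, q}" using sym by (auto simp: nbs_def)
    then have "card (nbs B a) \<le> card {p, q}" by (intro card_mono) auto
    then show False using degN(2)[OF that] card_2_iff[of "{p,q}"] by (cases "p = q") auto
  qed
  have nE: "\<not> E u' a" if "E u a" "E u u'" "a \<in> N" "u \<in> B" "u' \<in> B" for u u' a
    using tri[of u a u'] that subs sym by blast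
  have t1: "E c0 a1 \<or> E c1 a1"
  proof -
    have "\<not> E x a1" "\<not> E y a1" "\<not> E c2 a1" "\<not> E c4 a1"
      using nE[of w a1 x] nE[of w a1 y] nE[of c3 a1 c2] nE[of c3 a1 c4] ea a12 eB aN memB sym by blast+
    then show ?thesis using third[OF aN(1), of w c3] B by auto
  qed
  have t2: "E c1 a2 \<or> E c2 a2"
  proof -
    have "\<not> E x a2" "\<not> E y a2" "\<not> E c0 a2" "\<not> E c3 a2"
      using nE[of w a2 x] nE[of w a2 y] nE[of c4 a2 c0] nE[of c4 a2 c3] ea a12 eB aN memB sym by blast+
    then show ?thesis using third[OF aN(2), of w c4] B by auto
  qed
  have t3: "E y a3 \<or> E c0 a3"
  proof -
    have "\<not> E w a3" "\<not> E c1 a3" "\<not> E c2 a3" "\<not> E c4 a3"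
      using nE[of x a3 w] nE[of x a3 c1] nE[of c3 a3 c2] nE[of c3 a3 c4] ea a34 eB aN memB sym by blast+
    then show ?thesis using third[OF aN(3), of x c3] B by auto
  qed
  have t4: "E y a4 \<or> E c2 a4"
  proof -
    have "\<not> E w a4" "\<not> E c1 a4" "\<not> E c0 a4" "\<not> E c3 a4"
      using nE[of x a4 w] nE[of x a4 c1] nE[of c4 a4 c0] nE[of c4 a4 c3] ea a34 eB aN memB sym by blast+
    then show ?thesis using third[OF aN(4), of x c4] B by auto
  qed
  have da: "distinct [a1, a2, a3, a4]" by (rule card_distinct) (use N cN in \<open>simp only: list.set, simp\<close>)
  \<comment> \<open>Applied to the vertices of the 4-cycle, which have a single neighbour in
    \<open>N\<close>: one choice of an edge then determines the other three.\<close>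
  have uniq: False if "card (nbs N u) = 1" "E u a" "E u b" "a \<in> N" "b \<in> N" "a \<noteq> b" for u a b
  proof -
    have "a \<in> nbs N u" "b \<in> nbs N u" using that by (auto simp: nbs_def)
    then show False using that(1,6) by (auto simp: card_1_singleton_iff)
  qed
  have result: thesis if AA: "A = {v, a3, y, c0, c4, a4, x, w, a1, c3, c2, c1, a2}"
    and e: "E v a1" "E v a2" "E v a3" "E v a4" "E w x" "E w y" "E x c1" "E y c0" "E y c2" "E c0 c1"
     "E c0 c4" "E c1 c2" "E c2 c3" "E c3 c4" "E w a1" "E w a2" "E x a3" "E x a4"
     "E c3 a1" "E c4 a2" "E c3 a3" "E c4 a4" "E c0 a1" "E c1 a2" "E y a3" "E c2 a4"
   for w x y c0 c1 c2 c3 c4 a1 a2 a3 a4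
  proof -
    \<comment> \<open>A Hamiltonian cycle chosen such that vertices five places apart are adjacent
      too; its edges and these chords are the 26 edges in \<open>e\<close>.\<close>
    let ?xs = "[v, a3, y, c0, c4, a4, x, w, a1, c3, c2, c1, a2]"
    have s: "set ?xs = A" using AA by simp
    have "circulant_13_1_5 ?xs"
    proof (rule circulant_13_1_5I)
      show "distinct ?xs" using s c by (intro card_distinct) (simp only:, simp)
      show "card (nbs (set ?xs) u) \<le> 4" if "u \<in> set ?xs" for u using that deg unfolding s by simp
      fix i :: nat assume "i < 13"
      then have "i \<in> {0, 1, 2, 3, 4, 5, 6, 7, 8, 9, 10, 11, 12}" by (simp, presburger)
      then show "E (?xs ! i) (?xs ! ((i + 1) mod 13)) \<and> E (?xs ! i) (?xs ! ((i + 5) mod 13))"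
        using e e[THEN sym] by (elim insertE) simp_all
    qed simp
    then show thesis by (rule conclude[OF s])
  qed
  have AA: "A = {v, a1, a2, a3, a4, w, x, y, c0, c1, c2, c3, c4}" using A N B by auto
  show thesis
  proof (cases "E c0 a1")
    case True
    then have "\<not> E c0 a3" using uniq[of c0 a1 a3] cn aN da by auto
    then have 3: "E y a3" using t3 by blast
    then have "\<not> E y a4" using uniq[of y a3 a4] cn aN da by auto
    then have 4: "E c2 a4" using t4 by blast
    then have "\<not> E c2 a2" using uniq[of c2 a4 a2] cn aN da by auto
    then have 2: "E c1 a2" using t2 by blast
    show thesis
      by (rule result[of a3 y c0 c4 a4 x w a1 c3 c2 c1 a2])
        (use AA True 2 3 4 aN[THEN vadj] ea a12 a34 eB in auto)
  next
    case False
    then have 1: "E c1 a1" using t1 by blast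
    then have "\<not> E c1 a2" using uniq[of c1 a1 a2] cn aN da by auto
    then have 2: "E c2 a2" using t2 by blast
    then have "\<not> E c2 a4" using uniq[of c2 a2 a4] cn aN da by auto
    then have 4: "E y a4" using t4 by blast
    then have "\<not> E y a3" using uniq[of y a3 a4] cn aN da by auto
    then have 3: "E c0 a3" using t3 by blast
    \<comment> \<open>The exchange of \<open>w\<close>, \<open>x\<close> and of \<open>y\<close>,
      \<open>c1\<close> also swaps \<open>a1\<close> with \<open>a3\<close> and \<open>a2\<close>
      with \<open>a4\<close>.\<close>
    show thesis
      by (rule result[of a1 c1 c0 c4 a2 w x a3 c3 c2 y a4])
        (use AA 1 2 3 4 aN[THEN vadj] ea a12 a34 eB eB[THEN sym] in auto)
  qed
qed

subsection \<open>Gallai's lemma\<close>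

text \<open>A matching is encoded as an involution moving exactly the matched vertices.\<close>

definition matching :: "'a set \<Rightarrow> ('a \<Rightarrow> 'a) \<Rightarrow> bool" where
  "matching A f \<longleftrightarrow> (\<forall>x. f (f x) = x \<and> (f x \<noteq> x \<longrightarrow> x \<in> A \<and> E x (f x)))"

definition unmatched :: "'a set \<Rightarrow> ('a \<Rightarrow> 'a) \<Rightarrow> 'a set" where
  "unmatched A f = {x\<in>A. f x = x}"

definition max_matching :: "'a set \<Rightarrow> ('a \<Rightarrow> 'a) \<Rightarrow> bool" where
  "max_matching A f \<longleftrightarrow>
     matching A f \<and> (\<forall>g. matching A g \<longrightarrow> card (unmatched A f) \<le> card (unmatched A g))"

lemma matching_closed: "matching A f \<Longrightarrow> x \<in> A \<Longrightarrow> f x \<in> A"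
  unfolding matching_def by metis

lemma matching_involution: "matching A f \<Longrightarrow> f (f x) = x"
  unfolding matching_def by blast

lemma matching_edge: "matching A f \<Longrightarrow> f x \<noteq> x \<Longrightarrow> E x (f x)"
  unfolding matching_def by blast

lemma ex_max_matching: "\<exists>f. max_matching A f"
proof -
  have "matching A id" by (simp add: matching_def)
  then show ?thesis using ex_has_least_nat[of "matching A" id "\<lambda>f. card (unmatched A f)"]
    unfolding max_matching_def by blast
qed

lemma even_card_unmatched:
  assumes "finite A" "matching A f"
  shows "even (card A + card (unmatched A f))"
  unfolding unmatched_def
  by (rule even_card_involution[OF assms(1)])
    (use matching_closed[OF assms(2)] matching_involution[OF assms(2)] in auto)

lemma matching_add_edge:
  assumes "matching A f" "x \<in> A" "y \<in> A" "E x y" "f x = x" "f y = y"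
  shows "matching A (f(x := y, y := x))"
  unfolding matching_def
proof
  fix z
  have *: "f (f w) = w \<and> (f w \<noteq> w \<longrightarrow> w \<in> A \<and> E w (f w))" for w
    using assms(1) by (simp add: matching_def)
  show "(f(x := y, y := x)) ((f(x := y, y := x)) z) = z \<and>
      ((f(x := y, y := x)) z \<noteq> z \<longrightarrow> z \<in> A \<and> E z ((f(x := y, y := x)) z))"
    using assms(2-6) *[of z] *[of x] *[of y] sym[OF assms(4)] by (auto simp: fun_upd_def)
qed

lemma matching_remove_edge:
  assumes "matching A f"
  shows "matching A (f(y := y, f y := f y))"
  unfolding matching_def
proof
  fix z
  have *: "f (f w) = w \<and> (f w \<noteq> w \<longrightarrow> w \<in> A \<and> E w (f w))" for w
    using assms(1) by (simp add: matching_def)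
  show "(f(y := y, f y := f y)) ((f(y := y, f y := f y)) z) = z \<and>
      ((f(y := y, f y := f y)) z \<noteq> z \<longrightarrow> z \<in> A \<and> E z ((f(y := y, f y := f y)) z))"
    using *[of z] *[of y] by (auto simp: fun_upd_def)
qed

lemma max_matching_no_edge:
  assumes "finite A" "max_matching A f" "x \<in> A" "y \<in> A" "f x = x" "f y = y"
  shows "\<not> E x y"
proof
  assume e: "E x y"
  let ?g = "f(x := y, y := x)"
  have "matching A ?g" using matching_add_edge assms e by (auto simp: max_matching_def)
  then have "card (unmatched A f) \<le> card (unmatched A ?g)" using assms by (auto simp: max_matching_def)
  moreover have "unmatched A ?g \<subset> unmatched A f"
    using assms E_neq[OF e] by (auto simp: unmatched_def)
  then have "card (unmatched A ?g) < card (unmatched A f)"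
    using assms(1) by (intro psubset_card_mono) (auto simp: unmatched_def)
  ultimately show False by simp
qed

text \<open>The relation of Gallai's lemma. The disjunct \<open>u = v\<close> supplies reflexivity,
  since a single vertex may well be missed. Adjacent vertices of a finite \<open>A\<close> are
  linked, because the edge between two missed vertices would enlarge the matching.\<close>

definition linked :: "'a set \<Rightarrow> 'a \<Rightarrow> 'a \<Rightarrow> bool" where
  "linked A u v \<longleftrightarrow> u = v \<or> \<not> (\<exists>f. max_matching A f \<and> f u = u \<and> f v = v)"

lemma linked_sym: "linked A u v \<longleftrightarrow> linked A v u"
  unfolding linked_def by blast

text \<open>This is the exchange argument in Gallai's lemma: a maximum matching avoiding \<open>t\<close> that agrees
  as much as possible with one avoiding both \<open>u\<close> and \<open>v\<close> can be improved.\<close>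

lemma linked_trans:
  assumes fin: "finite A" and t: "\<exists>f. max_matching A f \<and> f t = t"
    and ut: "linked A u t" and tv: "linked A t v" and A: "u \<in> A" "v \<in> A"
  shows "linked A u v"
proof (rule ccontr)
  assume uv': "\<not> linked A u v"
  then obtain M where M: "max_matching A M" "M u = u" "M v = v" and uv: "u \<noteq> v"
    by (auto simp: linked_def)
  have tuv: "t \<noteq> u" "t \<noteq> v" using uv' ut tv by blast+
  have mM: "matching A M" using M by (simp add: max_matching_def)
  let ?P = "\<lambda>N. max_matching A N \<and> N t = t" and ?agree = "\<lambda>N. card {x\<in>A. M x = N x}"
  have agree: "\<forall>N. ?P N \<longrightarrow> ?agree N < Suc (card A)"
    using fin by (auto intro!: card_mono simp: less_Suc_eq_le)
  obtain N where N: "max_matching A N" "N t = t" and best: "\<And>N'. ?P N' \<Longrightarrow> ?agree N' \<le> ?agree N"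
  proof -
    obtain N0 where "?P N0" using t by blast
    from ex_has_greatest_nat[of ?P N0 ?agree "Suc (card A)", OF this agree]
    show thesis using that by blast
  qed
  have mN: "matching A N" using N by (simp add: max_matching_def)
  have Nuv: "N u \<noteq> u" "N v \<noteq> v" using ut tv N tuv by (auto simp: linked_def)
  have finU: "finite (unmatched A f)" for f using fin by (simp add: unmatched_def)
  have "card (unmatched A M) = card (unmatched A N)"
    using M N by (auto simp: max_matching_def intro: le_antisym)
  then have "card (unmatched A N - unmatched A M) = card (unmatched A M - unmatched A N)"
    using finU by (intro card_le_sym_Diff antisym) auto
  moreover have "{u, v} \<subseteq> unmatched A M - unmatched A N"
    using A M Nuv by (auto simp: unmatched_def)
  then have "card {u, v} \<le> card (unmatched A M - unmatched A N)" using finU by (intro card_mono) auto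
  \<comment> \<open>\<open>u\<close> and \<open>v\<close> are missed by \<open>M\<close> and covered
    by \<open>N\<close>; as both matchings miss equally many vertices, at least two are missed by
    \<open>N\<close> and covered by \<open>M\<close>, one of them different from
    \<open>t\<close>.\<close>
  ultimately have "2 \<le> card (unmatched A N - unmatched A M)" using uv by simp
  then have "\<not> unmatched A N - unmatched A M \<subseteq> {t}"
    using card_mono[of "{t}" "unmatched A N - unmatched A M"] by auto
  then obtain x where x: "x \<in> A" "N x = x" "M x \<noteq> x" "x \<noteq> t" by (auto simp: unmatched_def)
  define y where "y = M x"
  have y: "y \<noteq> x" "E x y" "y \<in> A" "M y = x"
    using x matching_edge[OF mM] matching_closed[OF mM] matching_involution[OF mM] by (auto simp: y_def)
  have Ny: "N y \<noteq> y" using max_matching_no_edge[OF fin N(1) x(1) y(3) x(2)] y by blast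
  define z where "z = N y"
  have z: "N z = y" "z \<noteq> y" "z \<in> A" using matching_involution[OF mN] matching_closed[OF mN] y Ny
    by (auto simp: z_def)
  then have zx: "z \<noteq> x" using x y by auto
  \<comment> \<open>The matching \<open>N\<close> is switched from the edge \<open>y z\<close> to
    the edge \<open>x y\<close>. It still misses \<open>t\<close> and loses no agreement with
    \<open>M\<close>: none of \<open>x\<close>, \<open>y\<close>, \<open>z\<close> agreed before,
    while \<open>x\<close> does now.\<close>
  let ?N1 = "N(y := y, z := z)"
  let ?N' = "?N1(x := y, y := x)"
  have "matching A ?N1" using matching_remove_edge[OF mN] by (simp add: z_def)
  then have mN': "matching A ?N'"
    using matching_add_edge[of A ?N1 x y] x y z zx by auto
  have "unmatched A ?N' = insert z (unmatched A N - {x})"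
    using x y z zx Ny by (auto simp: unmatched_def)
  moreover have "z \<notin> unmatched A N" "x \<in> unmatched A N" using x z by (auto simp: unmatched_def)
  ultimately have "card (unmatched A ?N') = card (unmatched A N)"
    using finU[of N] card_Suc_Diff1[of "unmatched A N" x] by simp
  then have "max_matching A ?N'" using N(1) mN' by (simp add: max_matching_def)
  moreover have "?N' t = t" using x N(2) Ny by auto
  ultimately have "?agree ?N' \<le> ?agree N" using best by blast
  moreover have "{w\<in>A. M w = N w} \<subset> {w\<in>A. M w = ?N' w}"
  proof
    show "{w\<in>A. M w = N w} \<subseteq> {w\<in>A. M w = ?N' w}"
    proof safe
      fix w assume w: "w \<in> A" "M w = N w"
      have "w \<noteq> x" "w \<noteq> y" using w x y zx by (auto simp: z_def)
      moreover have "w \<noteq> z" using w z zx y matching_involution[OF mM, of z] by auto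
      ultimately show "M w = ?N' w" using w by simp
    qed
    have "x \<in> {w\<in>A. M w = ?N' w}" "x \<notin> {w\<in>A. M w = N w}" using x y by (auto simp: y_def)
    then show "{w\<in>A. M w = N w} \<noteq> {w\<in>A. M w = ?N' w}" by blast
  qed
  then have "?agree N < ?agree ?N'" using fin by (intro psubset_card_mono) auto
  ultimately show False by simp
qed

text \<open>The classes are those of \<open>linked\<close>. Edges stay inside a class, so every
  maximum matching acts on each class, and it misses at most one vertex there. A maximum matching
  missing a given vertex shows that its class is odd; by parity every maximum matching then misses
  exactly one vertex per class.\<close>

lemma gallai_classes:
  assumes fin: "finite A" and all: "\<And>v. v \<in> A \<Longrightarrow> \<exists>f. max_matching A f \<and> f v = v"
    and f: "max_matching A f"
  obtains \<P> where "partition_on A \<P>" "card \<P> = card (unmatched A f)"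
    "\<And>C. C \<in> \<P> \<Longrightarrow> odd (card C)"
    "\<And>C x y. C \<in> \<P> \<Longrightarrow> x \<in> C \<Longrightarrow> y \<in> A \<Longrightarrow> E x y \<Longrightarrow> y \<in> C"
proof -
  define R where "R = {(u, v). u \<in> A \<and> v \<in> A \<and> linked A u v}"
  have eq: "equiv A R"
  proof (rule equivI)
    show "refl_on A R" by (auto simp: R_def refl_on_def linked_def)
    show "sym R" by (auto simp: R_def intro!: symI dest: linked_sym[THEN iffD1])
    show "trans R" unfolding R_def by (rule transI) (use linked_trans[OF fin all] in blast)
    show "R \<subseteq> A \<times> A" by (auto simp: R_def)
  qed
  let ?P = "A // R"
  have part: "partition_on A ?P" by (rule partition_on_quotient[OF eq])
  have cl: "(x, y) \<in> R \<Longrightarrow> x \<in> C \<Longrightarrow> C \<in> ?P \<Longrightarrow> y \<in> C" for x y C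
    using in_quotient_imp_closed[OF eq] by blast
  have rel: "C \<in> ?P \<Longrightarrow> x \<in> C \<Longrightarrow> y \<in> C \<Longrightarrow> (x, y) \<in> R" for x y C
    using quotient_eq_iff[OF eq] by blast
  have sub: "C \<subseteq> A" if "C \<in> ?P" for C using that in_quotient_imp_subset[OF eq] by blast
  have edge: "y \<in> C" if "C \<in> ?P" "x \<in> C" "y \<in> A" "E x y" for C x y
  proof -
    have "linked A x y" using max_matching_no_edge[OF fin] that sub unfolding linked_def by blast
    then have "(x, y) \<in> R" using that sub[of C] by (auto simp: R_def)
    then show ?thesis using cl that by blast
  qed
  have le1: "x = y" if "C \<in> ?P" "max_matching A g" "x \<in> C" "y \<in> C" "g x = x" "g y = y" for C g x y
    using rel[of C x y] that by (auto simp: R_def linked_def)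
  have parity: "even (card C + card (unmatched C g))" if C: "C \<in> ?P" and g: "max_matching A g" for C g
  proof -
    have m: "matching A g" using g by (simp add: max_matching_def)
    have "g ` C \<subseteq> C"
      using edge[OF C] sub[OF C] matching_edge[OF m] matching_closed[OF m] by (metis image_subsetI subsetD)
    then show ?thesis
      using even_card_involution[of C g] finite_subset[OF sub[OF C] fin] matching_involution[OF m]
      unfolding unmatched_def by blast
  qed
  have odd: "odd (card C)" if C: "C \<in> ?P" for C
  proof -
    obtain v where v: "v \<in> C" using C part partition_onD3 by fastforce
    then obtain g where g: "max_matching A g" "g v = v" using all sub[OF C] by blast
    then have "unmatched C g = {v}" using le1[OF C g(1)] v by (auto simp: unmatched_def)
    then show ?thesis using parity[OF C g(1)] by simp
  qed
  have one: "card (unmatched C f) = 1" if C: "C \<in> ?P" for C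
  proof -
    have "odd (card (unmatched C f))" using parity[OF C f] odd[OF C] by simp
    then have "card (unmatched C f) \<noteq> 0" by (metis even_zero)
    moreover have "card (unmatched C f) \<le> 1"
      using le1[OF C f] by (auto simp: unmatched_def card_le_Suc0_iff_eq finite_subset[OF sub[OF C] fin])
    ultimately show ?thesis by simp
  qed
  have "unmatched A f = (\<Union>C\<in>?P. unmatched C f)"
    using partition_onD1[OF part] by (auto simp: unmatched_def)
  also have "card \<dots> = (\<Sum>C\<in>?P. card (unmatched C f))"
  proof (rule card_UN_disjoint)
    show "finite ?P" by (rule finite_elements[OF fin part])
    show "\<forall>C\<in>?P. finite (unmatched C f)"
      using fin sub by (auto simp: unmatched_def intro: finite_subset)
    show "\<forall>C\<in>?P. \<forall>D\<in>?P. C \<noteq> D \<longrightarrow> unmatched C f \<inter> unmatched D f = {}"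
      using partition_onD2[OF part] by (fastforce simp: unmatched_def disjoint_def)
  qed
  also have "\<dots> = card ?P" using one by simp
  finally show thesis using that[OF part _ odd edge] by simp
qed

subsection \<open>Triangle-free graphs with a large gap\<close>

lemma ex_max_indep:
  assumes "finite A"
  obtains I where "I \<subseteq> A" "indep I" "indep_le A (card I)"
proof -
  let ?P = "\<lambda>S. S \<subseteq> A \<and> indep S"
  have "\<forall>S. ?P S \<longrightarrow> card S < Suc (card A)"
    using assms by (auto intro!: card_mono simp: less_Suc_eq_le)
  from ex_has_greatest_nat[of ?P "{}" card, OF _ this] show thesis
    using that indep_empty unfolding indep_le_def by blast
qed

text \<open>With |C| = 2\<nu> + 1 the inequality reads |C| - n \<le> 3\<nu>/2. It is the line
  through the extremal cases n = 1, 2, 4 with orders 1, 5, 13. For n = 3 the bound 8 and oddness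
  leave at most 7, short of 9, and from n = 4 on the assumption |C| \<le> 13 suffices.\<close>

lemma indep_number_odd_order:
  assumes fin: "finite C" and tf: "triangle_free C" and "odd (card C)" "card C \<le> 13"
    and le: "indep_le C n"
  shows "card C + 3 \<le> 4 * n" and "card C + 3 = 4 * n \<Longrightarrow> card C \<in> {1, 5, 13}"
proof -
  have 0: "n \<noteq> 0" using indep_le_0[OF fin] le \<open>odd (card C)\<close> by (metis card.empty even_zero)
  have 1: "card C \<le> 2" if "n = 1" using card_le_of_indep_le_1[OF fin tf] le that by simp
  have 2: "card C \<le> 5" if "n = 2" using card_le_of_indep_le_2[OF fin tf] le that by simp
  have 3: "card C \<le> 8" if "n = 3" using card_le_of_indep_le_3[OF fin tf] le that by simp
  have "n = 1 \<or> n = 2 \<or> n = 3 \<or> n \<ge> 4" using 0 by arith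
  then show "card C + 3 \<le> 4 * n" using assms(3,4) 1 2 3 by (elim disjE) presburger+
  assume eq: "card C + 3 = 4 * n"
  then have "n \<le> 4" "n \<noteq> 3" using assms(4) 3 by linarith+
  then have "n = 1 \<or> n = 2 \<or> n = 4" using 0 by arith
  then show "card C \<in> {1, 5, 13}" using eq by auto
qed

lemma card_partition_eq_sum:
  assumes "finite A" "partition_on A \<P>"
  shows "card A = (\<Sum>C\<in>\<P>. card C)"
proof -
  have "finite C" if "C \<in> \<P>" for C
    using that assms partition_onD1 by (metis Union_upper finite_subset)
  then show ?thesis
    using card_Union_disjoint[of \<P>] partition_onD1[OF assms(2)] partition_onD2[OF assms(2)]
    by simp
qed

text \<open>The last inequality says that the vertex cover number of \<open>A\<close> exceeds its matching number by
  at least \<open>k\<close>.\<close>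

lemma triangle_free_gap:
  assumes "finite A" "triangle_free A" "k \<le> 3" "max_matching A f"
    "card A \<le> card (unmatched A f) + 4 * k"
    "\<And>S. S \<subseteq> A \<Longrightarrow> indep S \<Longrightarrow> 2 * card S + 2 * k \<le> card A + card (unmatched A f)"
  shows "card A = card (unmatched A f) + 4 * k \<and>
    (\<exists>\<P>. partition_on A \<P> \<and> card \<P> = card (unmatched A f) \<and>
       (\<forall>C\<in>\<P>. card C \<in> {1, 5, 13} \<and> indep_le C ((card C + 3) div 4)) \<and>
       (\<forall>C\<in>\<P>. \<forall>x\<in>C. \<forall>y\<in>A. E x y \<longrightarrow> y \<in> C))"
  using assms
proof (induction "card A" arbitrary: A f rule: less_induct)
  case less
  note fin = \<open>finite A\<close> and tf = \<open>triangle_free A\<close> and k = \<open>k \<le> 3\<close> and f = \<open>max_matching A f\<close>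
  note nu = less.prems(5) and gap = less.prems(6)
  let ?d = "card (unmatched A f)"
  show ?case
  proof (cases "\<forall>v\<in>A. \<exists>g. max_matching A g \<and> g v = v")
    case True
    then have "\<And>v. v \<in> A \<Longrightarrow> \<exists>f. max_matching A f \<and> f v = v" by blast
    from gallai_classes[OF fin this f] obtain \<P> where P: "partition_on A \<P>" "card \<P> = ?d"
      and odd: "\<And>C. C \<in> \<P> \<Longrightarrow> odd (card C)"
      and edge: "\<And>C x y. C \<in> \<P> \<Longrightarrow> x \<in> C \<Longrightarrow> y \<in> A \<Longrightarrow> E x y \<Longrightarrow> y \<in> C" by blast
    have finP: "finite \<P>" by (rule finite_elements[OF fin P(1)])
    have sub: "C \<subseteq> A" if "C \<in> \<P>" for C using that partition_onD1[OF P(1)] by blast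
    have finC: "finite C" if "C \<in> \<P>" for C using sub[OF that] fin finite_subset by blast
    have tfC: "triangle_free C" if "C \<in> \<P>" for C using triangle_free_subset[OF tf sub[OF that]] .
    have cA: "card A = (\<Sum>C\<in>\<P>. card C)" by (rule card_partition_eq_sum[OF fin P(1)])
    \<comment> \<open>The other classes have at least one vertex each, so |C| - 1 \<le> |A| - d
      \<le> 4k \<le> 12, where d is the number of missed vertices.\<close>
    have le13: "card C \<le> 13" if C: "C \<in> \<P>" for C
    proof -
      have "card (\<P> - {C}) \<le> (\<Sum>D\<in>\<P> - {C}. card D)"
        using sum_mono[of "\<P> - {C}" "\<lambda>_. 1" card] odd by (fastforce intro: odd_pos simp: Suc_le_eq)
      then have "?d - 1 \<le> (\<Sum>D\<in>\<P> - {C}. card D)" using P(2) C finP by simp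
      then have "card C + ?d - 1 \<le> card A" using cA sum.remove[OF finP C, of card] by simp
      then show ?thesis using nu k by simp
    qed
    have "\<forall>C\<in>\<P>. \<exists>I. I \<subseteq> C \<and> indep I \<and> indep_le C (card I)"
      using ex_max_indep[OF finC] by metis
    then obtain I where I: "\<And>C. C \<in> \<P> \<Longrightarrow> I C \<subseteq> C \<and> indep (I C) \<and> indep_le C (card (I C))"
      by metis
    define S where "S = (\<Union>C\<in>\<P>. I C)"
    have "S \<subseteq> A" using I sub by (auto simp: S_def)
    moreover have "indep S"
      unfolding indep_def
    proof (intro ballI notI)
      fix x y assume "x \<in> S" "y \<in> S" and e: "E x y"
      then obtain C D where C: "C \<in> \<P>" "x \<in> I C" and D: "D \<in> \<P>" "y \<in> I D" by (auto simp: S_def)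
      then have "x \<in> C" "y \<in> D" "y \<in> A" using I sub by blast+
      then have "C = D" using edge[OF C(1) _ _ e] C D partition_onD2[OF P(1)]
        by (auto simp: disjoint_def)
      then show False using I[OF C(1)] C D e indepD by blast
    qed
    ultimately have "2 * card S + 2 * k \<le> card A + ?d" by (rule gap)
    moreover have "card S = (\<Sum>C\<in>\<P>. card (I C))"
      unfolding S_def
    proof (rule card_UN_disjoint[OF finP])
      show "\<forall>C\<in>\<P>. finite (I C)" using I finC finite_subset by blast
      show "\<forall>C\<in>\<P>. \<forall>D\<in>\<P>. C \<noteq> D \<longrightarrow> I C \<inter> I D = {}"
      proof (intro ballI impI)
        fix C D assume "C \<in> \<P>" "D \<in> \<P>" "C \<noteq> D"
        then have "C \<inter> D = {}" using partition_onD2[OF P(1)] by (auto simp: disjoint_def)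
        then show "I C \<inter> I D = {}" using I \<open>C \<in> \<P>\<close> \<open>D \<in> \<P>\<close> by blast
      qed
    qed
    moreover have bound: "card C + 3 \<le> 4 * card (I C)" if "C \<in> \<P>" for C
      using indep_number_odd_order(1)[OF finC tfC odd le13] I that by blast
    have tot: "(\<Sum>C\<in>\<P>. card C + 3) = card A + 3 * ?d" using cA P(2) by (simp add: sum.distrib)
    moreover have "(\<Sum>C\<in>\<P>. card C + 3) \<le> (\<Sum>C\<in>\<P>. 4 * card (I C))"
      using bound by (rule sum_mono)
    \<comment> \<open>|A| + 3d \<le> 4|S| \<le> 2(|A| + d) - 4k gives |A| \<ge> d + 4k, the reverse
      of the assumed bound; so the sums agree and every class attains equality.\<close>
    ultimately have *: "card A = ?d + 4 * k" and "(\<Sum>C\<in>\<P>. 4 * card (I C)) = (\<Sum>C\<in>\<P>. card C + 3)"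
      using nu by (simp_all add: sum_distrib_left[symmetric])
    then have eq: "card C + 3 = 4 * card (I C)" if "C \<in> \<P>" for C
      using that sum_mono_inv[of "\<lambda>C. card C + 3" \<P> "\<lambda>C. 4 * card (I C)" C] bound finP by simp
    have "card C \<in> {1, 5, 13} \<and> indep_le C ((card C + 3) div 4)" if C: "C \<in> \<P>" for C
    proof
      show "card C \<in> {1, 5, 13}"
        using indep_number_odd_order(2)[OF finC tfC odd le13 _ eq] I C by blast
      show "indep_le C ((card C + 3) div 4)" using I[OF C] eq[OF C] by simp
    qed
    then show ?thesis using * P edge by blast
  next
    case False
    \<comment> \<open>By parity, deleting such a vertex raises the number of missed vertices from d
      to some d' \<ge> d + 1. The induction hypothesis yields |B| = d' + 4k, so |A| exceeds the
      permitted d + 4k: this case is contradictory.\<close>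
    then obtain v where v: "v \<in> A" and ess: "\<And>g. max_matching A g \<Longrightarrow> g v \<noteq> v" by blast
    define B where "B = A - {v}"
    have cB: "card A = Suc (card B)" using card_Suc_Diff1[OF fin v] by (simp add: B_def)
    have B: "finite B" "card B < card A" "card A = Suc (card B)" "triangle_free B"
      using fin cB triangle_free_subset[OF tf, of B] by (auto simp: B_def)
    obtain g where g: "max_matching B g" using ex_max_matching by blast
    then have mg: "matching B g" by (simp add: max_matching_def)
    then have mA: "matching A g" by (auto simp: matching_def B_def)
    have gv: "g v = v" using mg by (auto simp: matching_def B_def)
    have "unmatched A g = insert v (unmatched B g)" "v \<notin> unmatched B g"
      using v gv by (auto simp: unmatched_def B_def)
    then have U: "card (unmatched A g) = Suc (card (unmatched B g))" using B(1) by (simp add: unmatched_def)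
    have "\<not> max_matching A g" using ess gv by blast
    then have "?d < card (unmatched A g)"
      using f mA unfolding max_matching_def by (meson le_less_trans not_le order_trans)
    moreover have "even (card A + ?d)" "even (card B + card (unmatched B g))"
      using even_card_unmatched fin B(1) f g by (auto simp: max_matching_def)
    then have "?d \<noteq> card (unmatched B g)" using B(3) by auto
    ultimately have ge: "card (unmatched B g) \<ge> Suc ?d" using U by simp
    have "card B = card (unmatched B g) + 4 * k"
    proof -
      have "card B \<le> card (unmatched B g) + 4 * k" using ge nu B(3) by simp
      moreover have "2 * card S + 2 * k \<le> card B + card (unmatched B g)" if "S \<subseteq> B" "indep S" for S
        using gap[of S] that ge B(3) by (force simp: B_def)
      ultimately show ?thesis using less.hyps[of B g] B k g by blast
    qed
    then show ?thesis using ge nu B(3) by simp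
  qed
qed

subsection \<open>Excluding triangles\<close>

definition is_clique :: "'a set \<Rightarrow> bool" where
  "is_clique K \<longleftrightarrow> (\<forall>x\<in>K. \<forall>y\<in>K. x \<noteq> y \<longrightarrow> E x y)"

definition clique_cover :: "'a set \<Rightarrow> nat \<Rightarrow> bool" where
  "clique_cover A m \<longleftrightarrow> (\<exists>\<K>. finite \<K> \<and> card \<K> \<le> m \<and> (\<forall>K\<in>\<K>. is_clique K) \<and> A \<subseteq> \<Union>\<K>)"

text \<open>On the complementary graph this says \<open>\<chi> \<ge> |A| - 2k\<close> and \<open>\<omega> \<le> |A| - 3k\<close>.\<close>

definition gap_graph :: "nat \<Rightarrow> 'a set \<Rightarrow> bool" where
  "gap_graph k A \<longleftrightarrow> finite A \<and> (\<forall>m. clique_cover A m \<longrightarrow> card A \<le> m + 2 * k) \<and>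
     (\<forall>S\<subseteq>A. indep S \<longrightarrow> card S + 3 * k \<le> card A)"

text \<open>The last clause makes the vertices outside \<Union>\<C> isolated and, with disjointness,
  rules out edges between different cycles.\<close>

definition five_cycles :: "'a set set \<Rightarrow> 'a set \<Rightarrow> bool" where
  "five_cycles \<C> A \<longleftrightarrow> finite \<C> \<and> disjoint \<C> \<and> \<Union>\<C> \<subseteq> A \<and>
     (\<forall>P\<in>\<C>. \<exists>p q r s t. P = {p, q, r, s, t} \<and> C5 p q r s t) \<and>
     (\<forall>x\<in>A. \<forall>y\<in>A. E x y \<longrightarrow> (\<exists>P\<in>\<C>. x \<in> P \<and> y \<in> P))"

section \<open>Building clique covers\<close>

lemma clique_cover_empty: "clique_cover {} 0"
  unfolding clique_cover_def by (intro exI[of _ "{}"]) auto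

lemma clique_cover_insert:
  assumes "clique_cover A m" "is_clique K" "B \<subseteq> A \<union> K"
  shows "clique_cover B (Suc m)"
proof -
  from assms(1) obtain \<K> where K: "finite \<K>" "card \<K> \<le> m" "\<forall>K\<in>\<K>. is_clique K" "A \<subseteq> \<Union>\<K>"
    by (auto simp: clique_cover_def)
  have "card (insert K \<K>) \<le> Suc m" using K(1,2) by (simp add: card_insert_if)
  then show ?thesis unfolding clique_cover_def
    using K assms(2,3) by (intro exI[of _ "insert K \<K>"]) auto
qed

lemma is_clique_singleton: "is_clique {x}" and is_clique_edge: "E x y \<Longrightarrow> is_clique {x, y}"
  using sym by (auto simp: is_clique_def)

lemma clique_cover_Un_singletons:
  assumes "clique_cover A m" "finite W"
  shows "clique_cover (A \<union> W) (m + card W)"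
  using assms(2)
proof induction
  case (insert w W)
  have "clique_cover (A \<union> insert w W) (Suc (m + card W))"
    by (rule clique_cover_insert[OF insert.IH is_clique_singleton[of w]]) auto
  then show ?case using insert by simp
qed (use assms(1) in simp)

lemma clique_cover_C5:
  assumes "clique_cover A m" "C5 p q r s t"
  shows "clique_cover (A \<union> {p, q, r, s, t}) (m + 3)"
proof -
  have e: "E p q" "E r s" using assms(2) by (auto simp: C5_def)
  have 1: "clique_cover (A \<union> {p, q}) (Suc m)"
    by (rule clique_cover_insert[OF assms(1) is_clique_edge[OF e(1)]]) simp
  have 2: "clique_cover (A \<union> {p, q, r, s}) (Suc (Suc m))"
    by (rule clique_cover_insert[OF 1 is_clique_edge[OF e(2)]]) auto
  have "clique_cover (A \<union> {p, q, r, s, t}) (Suc (Suc (Suc m)))"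
    by (rule clique_cover_insert[OF 2 is_clique_singleton[of t]]) auto
  then show ?thesis by (simp add: eval_nat_numeral)
qed

lemma clique_cover_five_cycles:
  assumes "finite \<C>" "\<forall>P\<in>\<C>. \<exists>p q r s t. P = {p, q, r, s, t} \<and> C5 p q r s t"
  shows "clique_cover (\<Union>\<C>) (3 * card \<C>)"
  using assms
proof induction
  case (insert P \<C>)
  from insert.prems have "\<exists>p q r s t. P = {p, q, r, s, t} \<and> C5 p q r s t" by simp
  then obtain p q r s t where P: "P = {p, q, r, s, t}" "C5 p q r s t" by blast
  have "clique_cover (\<Union>\<C> \<union> P) (3 * card \<C> + 3)"
    unfolding P(1) by (rule clique_cover_C5[OF insert.IH P(2)]) (use insert.prems in simp)
  then show ?case using insert.hyps by (simp add: Un_commute add.commute)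
qed (simp add: clique_cover_empty)

text \<open>The orbits of the involution are the matching edges together with the missed vertices as
  singletons.\<close>

lemma clique_cover_matching:
  assumes "finite A" "matching A f"
  shows "clique_cover A ((card A + card (unmatched A f)) div 2)"
proof -
  let ?K = "(\<lambda>x. {x, f x}) ` A"
  have "2 * card ?K = card A + card (unmatched A f)"
    unfolding unmatched_def
    by (rule card_involution_orbits[OF assms(1)])
      (use matching_closed[OF assms(2)] matching_involution[OF assms(2)] in auto)
  moreover have "is_clique {x, f x}" for x
    using is_clique_edge matching_edge[OF assms(2)] is_clique_singleton by (cases "f x = x") auto
  ultimately show ?thesis
    unfolding clique_cover_def using assms(1) by (intro exI[of _ ?K]) auto
qed

section \<open>Induced 5-cycles and their disjoint unions\<close>

lemma C5_card: "C5 p q r s t \<Longrightarrow> card {p, q, r, s, t} = 5"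
  by (auto simp: C5_def)

lemma C5_rotate: "C5 p q r s t \<Longrightarrow> C5 q r s t p"
  unfolding C5_def using sym by auto

text \<open>Visiting every second vertex of a 5-cycle traverses the 5-cycle formed by its non-edges;
  thus the cycles of the complement reappear as cycles of the original graph.\<close>

lemma C5_complement:
  assumes C: "C5 p q r s t" and i: "i < 5" and j: "j < 5"
  defines "xs \<equiv> [p, r, t, q, s]"
  shows "xs ! i \<noteq> xs ! j \<and> \<not> E (xs ! i) (xs ! j) \<longleftrightarrow> j = Suc i mod 5 \<or> i = Suc j mod 5"
proof -
  note e = C[unfolded C5_def]
  have s: "E q p" "E r q" "E s r" "E t s" "E p t" "\<not> E r p" "\<not> E s q" "\<not> E t r" "\<not> E p s" "\<not> E q t"
    using e sym by blast+
  have d: "q \<noteq> p" "r \<noteq> p" "s \<noteq> p" "t \<noteq> p" "r \<noteq> q" "s \<noteq> q" "t \<noteq> q" "s \<noteq> r" "t \<noteq> r" "t \<noteq> s"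
    using e by auto
  have "i = 0 \<or> i = 1 \<or> i = 2 \<or> i = 3 \<or> i = 4" "j = 0 \<or> j = 1 \<or> j = 2 \<or> j = 3 \<or> j = 4"
    using i j by arith+
  then show ?thesis using e s d unfolding xs_def by (elim disjE) (simp_all add: irrefl)
qed

lemma five_cyclesD:
  assumes "five_cycles \<C> A"
  shows "finite \<C>" "disjoint \<C>" "\<Union>\<C> \<subseteq> A"
    "\<And>P. P \<in> \<C> \<Longrightarrow> \<exists>p q r s t. P = {p, q, r, s, t} \<and> C5 p q r s t"
    "\<And>x y P. x \<in> A \<Longrightarrow> y \<in> A \<Longrightarrow> E x y \<Longrightarrow> P \<in> \<C> \<Longrightarrow> x \<in> P \<Longrightarrow> y \<in> P"
    "\<And>x y. x \<in> A \<Longrightarrow> y \<in> A \<Longrightarrow> E x y \<Longrightarrow> \<exists>P\<in>\<C>. x \<in> P"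
proof -
  show "finite \<C>" "disjoint \<C>" "\<Union>\<C> \<subseteq> A"
    and "\<And>P. P \<in> \<C> \<Longrightarrow> \<exists>p q r s t. P = {p, q, r, s, t} \<and> C5 p q r s t"
    using assms by (auto simp: five_cycles_def)
  have edge: "\<forall>x\<in>A. \<forall>y\<in>A. E x y \<longrightarrow> (\<exists>P\<in>\<C>. x \<in> P \<and> y \<in> P)"
    using assms by (simp add: five_cycles_def)
  then show "\<And>x y. x \<in> A \<Longrightarrow> y \<in> A \<Longrightarrow> E x y \<Longrightarrow> \<exists>P\<in>\<C>. x \<in> P" by blast
  fix x y P assume x: "x \<in> A" "y \<in> A" "E x y" "P \<in> \<C>" "x \<in> P"
  then obtain P' where "P' \<in> \<C>" "x \<in> P'" "y \<in> P'" using edge by blast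
  then show "y \<in> P" using x \<open>disjoint \<C>\<close> by (metis IntI disjointD empty_iff)
qed

lemma C5_from_vertex:
  assumes "C5 p q r s t" "v \<in> {p, q, r, s, t}"
  obtains q' r' s' t' where "{p, q, r, s, t} = {v, q', r', s', t'}" "C5 v q' r' s' t'"
proof -
  note 1 = assms(1)
  note 2 = C5_rotate[OF 1] note 3 = C5_rotate[OF 2] note 4 = C5_rotate[OF 3] note 5 = C5_rotate[OF 4]
  from assms(2) show thesis
    by (elim insertE emptyE)
      (use that[of q r s t] that[of r s t p] that[of s t p q] that[of t p q r] that[of p q r s] 1 2 3 4 5
        in \<open>auto simp: insert_commute\<close>)
qed

text \<open>A vertex with a neighbour lies on one of the cycles and has just two neighbours there,
  so a path on three vertices closes up to a 5-cycle. This forces new neighbours to exist after a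
  different triangle is deleted.\<close>

lemma five_cycles_path:
  assumes fc: "five_cycles \<C> A" and A: "x \<in> A" "y \<in> A" "z \<in> A" and e: "E x y" "E y z" "x \<noteq> z"
  obtains u w where "u \<in> A" "w \<in> A" "E z u" "E u w" "E w x" "u \<noteq> y" "w \<noteq> y"
    "u \<noteq> x" "w \<noteq> z" "u \<noteq> w"
    "\<And>v. v \<in> A \<Longrightarrow> E y v \<Longrightarrow> v = x \<or> v = z"
proof -
  obtain P where P: "P \<in> \<C>" "y \<in> P" using five_cyclesD(6)[OF fc A(2,3) e(2)] by blast
  have sub: "P \<subseteq> A" using five_cyclesD(3)[OF fc] P by blast
  obtain q r s t where C: "P = {y, q, r, s, t}" "C5 y q r s t"
    using five_cyclesD(4)[OF fc P(1)] C5_from_vertex P(2) by metis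
  have inP: "v \<in> P" if "v \<in> A" "E y v" for v using five_cyclesD(5)[OF fc A(2) that P] .
  have nb: "v = q \<or> v = t" if "v \<in> A" "E y v" for v
    using inP[OF that] that C irrefl sym by (auto simp: C5_def)
  have "x = q \<or> x = t" "z = q \<or> z = t" using nb A e sym by blast+
  then consider "x = q" "z = t" | "x = t" "z = q" using e(3) by blast
  then show thesis
  proof cases
    case 1
    show thesis by (rule that[of s r]) (use C sub nb sym 1 in \<open>auto simp: C5_def\<close>)
  next
    case 2
    show thesis by (rule that[of r s]) (use C sub nb sym 2 in \<open>auto simp: C5_def\<close>)
  qed
qed

lemma five_cycles_path_nbs:
  assumes "five_cycles \<C> A" "x \<in> A" "y \<in> A" "z \<in> A" "E x y" "E y z" "x \<noteq> z"
    and "v \<in> A" "E y v"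
  shows "v = x \<or> v = z"
  by (rule five_cycles_path[OF assms(1-7)]) (use assms(8,9) in blast)

lemma five_cycles_cover: "five_cycles \<C> A \<Longrightarrow> clique_cover (\<Union>\<C>) (3 * card \<C>)"
  by (rule clique_cover_five_cycles) (simp_all add: five_cycles_def)

lemma card_five_cycles:
  assumes "five_cycles \<C> A"
  shows "card (\<Union>\<C>) = 5 * card \<C>"
proof -
  have "card P = 5" if "P \<in> \<C>" for P using five_cyclesD(4)[OF assms that] C5_card by blast
  moreover have "finite P" if "P \<in> \<C>" for P using five_cyclesD(4)[OF assms that] by auto
  ultimately show ?thesis
    using card_Union_disjoint[of \<C>] five_cyclesD(2)[OF assms] by simp
qed

text \<open>Each cycle gives up 3 of its vertices, all isolated ones stay, and \<open>a\<close> is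
  gained. A cycle has a non-adjacent pair avoiding the neighbours of \<open>a\<close> unless these
  contain three consecutive vertices: such triples are exactly the minimal vertex covers of the
  complementary 5-cycle.\<close>

lemma five_cycles_extend_indep:
  assumes fin: "finite A" and fc: "five_cycles \<C> A" and a: "a \<notin> A"
    and iso: "\<And>w. w \<in> A - \<Union>\<C> \<Longrightarrow> \<not> E a w"
    and path: "\<And>p q r s t. {p, q, r, s, t} \<in> \<C> \<Longrightarrow> C5 p q r s t \<Longrightarrow> \<not> (E a p \<and> E a q \<and> E a r)"
  obtains S where "S \<subseteq> insert a A" "indep S" "card S + 3 * card \<C> = Suc (card A)"
proof -
  have "\<exists>Q. Q \<subseteq> P \<and> card Q = 2 \<and> indep Q \<and> (\<forall>x\<in>Q. \<not> E a x)" if P: "P \<in> \<C>" for P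
  proof -
    obtain p q r s t where C: "P = {p, q, r, s, t}" "C5 p q r s t"
      using five_cyclesD(4)[OF fc P] by blast
    note C1 = C5_rotate[OF C(2)] note C2 = C5_rotate[OF C1] note C3 = C5_rotate[OF C2]
    note C4 = C5_rotate[OF C3]
    have "\<not> (E a p \<and> E a q \<and> E a r)" "\<not> (E a q \<and> E a r \<and> E a s)" "\<not> (E a r \<and> E a s \<and> E a t)"
      "\<not> (E a s \<and> E a t \<and> E a p)" "\<not> (E a t \<and> E a p \<and> E a q)"
      using path[OF _ C(2)] path[OF _ C1] path[OF _ C2] path[OF _ C3] path[OF _ C4] P C(1)
      by (simp_all add: insert_commute)
    then have "\<not> E a p \<and> \<not> E a r \<or> \<not> E a q \<and> \<not> E a s \<or> \<not> E a r \<and> \<not> E a t \<or> \<not> E a s \<and> \<not> E a p \<or>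
        \<not> E a t \<and> \<not> E a q" by blast
    moreover have ind: "indep {p, r}" "indep {q, s}" "indep {r, t}" "indep {s, p}" "indep {t, q}"
      using C(2) irrefl sym by (auto simp: C5_def indep_def)
    moreover have "card {p, r} = 2" "card {q, s} = 2" "card {r, t} = 2" "card {s, p} = 2" "card {t, q} = 2"
      using C(2) by (auto simp: C5_def)
    ultimately show ?thesis unfolding C(1)
      by (elim disjE) (rule exI[of _ "{p, r}"], force, rule exI[of _ "{q, s}"], force,
        rule exI[of _ "{r, t}"], force, rule exI[of _ "{s, p}"], force, rule exI[of _ "{t, q}"], force)
  qed
  then obtain Q where Q: "\<And>P. P \<in> \<C> \<Longrightarrow> Q P \<subseteq> P \<and> card (Q P) = 2 \<and> indep (Q P) \<and> (\<forall>x\<in>Q P. \<not> E a x)"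
    by metis
  let ?U = "\<Union>P\<in>\<C>. Q P" and ?W = "A - \<Union>\<C>"
  have "card ?U = 2 * card \<C>"
  proof -
    have "\<forall>P\<in>\<C>. \<forall>P'\<in>\<C>. P \<noteq> P' \<longrightarrow> Q P \<inter> Q P' = {}"
    proof (intro ballI impI)
      fix P P' assume P: "P \<in> \<C>" "P' \<in> \<C>" "P \<noteq> P'"
      then have "P \<inter> P' = {}" using five_cyclesD(2)[OF fc] by (simp add: disjointD)
      then show "Q P \<inter> Q P' = {}" using Q P(1,2) by blast
    qed
    moreover have "\<forall>P\<in>\<C>. finite (Q P)" using Q by (metis card.infinite zero_neq_numeral)
    ultimately show ?thesis using card_UN_disjoint[OF five_cyclesD(1)[OF fc], of Q] Q by simp
  qed
  moreover have "card ?W + 5 * card \<C> = card A"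
    using card_five_cycles[OF fc] five_cyclesD(3)[OF fc] fin
    by (metis Diff_disjoint Un_Diff_cancel2 card_Un_disjoint finite_Diff finite_subset sup.absorb_iff1 inf_commute)
  moreover have UA: "?U \<subseteq> \<Union>\<C>" using Q by blast
  then have finU: "finite ?U" using five_cyclesD(3)[OF fc] fin by (meson finite_subset)
  have "card (insert a (?U \<union> ?W)) = Suc (card ?U + card ?W)"
  proof -
    have "a \<notin> ?U \<union> ?W" using a UA five_cyclesD(3)[OF fc] by blast
    moreover have "?U \<inter> ?W = {}" using UA by blast
    ultimately show ?thesis using finU fin by (simp add: card_Un_disjoint)
  qed
  ultimately have "card (insert a (?U \<union> ?W)) + 3 * card \<C> = Suc (card A)" by simp
  moreover have "insert a (?U \<union> ?W) \<subseteq> insert a A" using UA five_cyclesD(3)[OF fc] by blast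
  moreover have "indep (insert a (?U \<union> ?W))"
  proof -
    have 1: "\<not> E a x" if "x \<in> ?U \<union> ?W" for x using that Q iso by blast
    have "\<not> E x y" if x: "x \<in> ?U \<union> ?W" and y: "y \<in> ?U \<union> ?W" for x y
    proof
      assume e: "E x y"
      have A: "x \<in> A" "y \<in> A" using x y UA five_cyclesD(3)[OF fc] by blast+
      obtain P where P: "P \<in> \<C>" "x \<in> P" using five_cyclesD(6)[OF fc A e] by blast
      then have yP: "y \<in> P" using five_cyclesD(5)[OF fc A e] by blast
      have "z \<in> Q P" if "z \<in> ?U \<union> ?W" "z \<in> P" for z
      proof -
        have "z \<in> ?U" using that P by blast
        then obtain P' where P': "P' \<in> \<C>" "z \<in> Q P'" by blast
        then have "z \<in> P'" using Q by blast
        then have "P' = P" using disjointD[OF five_cyclesD(2)[OF fc] P'(1) P(1)] that by blast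
        then show ?thesis using P' by simp
      qed
      then have "x \<in> Q P" "y \<in> Q P" using x y P yP by blast+
      then show False using Q[OF P(1)] e indepD by blast
    qed
    then show ?thesis using 1 irrefl sym unfolding indep_def by blast
  qed
  ultimately show thesis using that by blast
qed


text \<open>Deleting a triangle lowers both parameters by one, so the rest is a disjoint union of 5-cycles
  and isolated vertices; every way of attaching the triangle to it creates a larger clique packing.\<close>

context
  fixes k :: nat and A :: "'a set"
  assumes gap: "gap_graph (Suc k) A"
    and IH: "\<And>B. gap_graph k B \<Longrightarrow> \<exists>\<C>. five_cycles \<C> B \<and> card \<C> = k"
begin

lemma finite_gap_graph: "finite A"
  and gap_graph_cover: "\<And>m. clique_cover A m \<Longrightarrow> card A \<le> m + 2 * k + 2"
  and gap_graph_indep: "\<And>S. S \<subseteq> A \<Longrightarrow> indep S \<Longrightarrow> card S + 3 * k + 3 \<le> card A"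
  using gap by (force simp: gap_graph_def)+

text \<open>The triangle extends a cover of the rest by one clique while adding 3 vertices, which
  accounts for the 2 in \<open>2 * k\<close>; in the independence bound the 3 lost vertices balance
  the 3 in \<open>3 * k\<close>.\<close>

lemma remove_triangle:
  assumes T: "a \<in> A" "b \<in> A" "c \<in> A" "E a b" "E b c" "E a c"
  obtains \<C> where "five_cycles \<C> (A - {a, b, c})" "card \<C> = k" "card A = card (A - {a, b, c}) + 3"
proof -
  let ?B = "A - {a, b, c}"
  have "card {a, b, c} = 3" using T E_neq by (auto simp: card_insert_if)
  then have c: "card A = card ?B + 3"
    using card_Diff_subset[of "{a, b, c}" A] card_mono[OF finite_gap_graph, of "{a, b, c}"] T by simp
  have is_clique: "is_clique {a, b, c}" using T sym by (auto simp: is_clique_def)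
  have "gap_graph k ?B"
    unfolding gap_graph_def
  proof (intro conjI allI impI)
    show "finite ?B" using finite_gap_graph by simp
    fix m assume "clique_cover ?B m"
    from clique_cover_insert[OF this is_clique, of A] show "card ?B \<le> m + 2 * k"
      using gap_graph_cover[of "Suc m"] c by auto
  next
    fix S assume "S \<subseteq> ?B" "indep S"
    then show "card S + 3 * k \<le> card ?B" using gap_graph_indep[of S] c by auto
  qed
  then show thesis using IH that c by blast
qed

text \<open>Otherwise \<open>a p q\<close> and \<open>a q r\<close> are triangles too. With the
  first removed, the path \<open>r s t\<close> closes through a neighbour \<open>u\<close> of
  \<open>t\<close> other than \<open>s\<close>, which must be \<open>b\<close> or \<open>c\<close>.
  With the second removed, \<open>u\<close> is still present, yet \<open>t\<close> has only the
  neighbours \<open>s\<close> and \<open>p\<close>.\<close>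

lemma triangle_path_free:
  assumes T: "a \<in> A" "b \<in> A" "c \<in> A" "E a b" "E b c" "E a c"
    and fc: "five_cycles \<C> (A - {a, b, c})" and P: "{p, q, r, s, t} \<in> \<C>" and C: "C5 p q r s t"
  shows "\<not> (E a p \<and> E a q \<and> E a r)"
proof
  assume e: "E a p \<and> E a q \<and> E a r"
  let ?B = "A - {a, b, c}"
  have "{p, q, r, s, t} \<subseteq> ?B" using five_cyclesD(3)[OF fc] P by blast
  then have B: "p \<in> ?B" "q \<in> ?B" "r \<in> ?B" "s \<in> ?B" "t \<in> ?B" by auto
  note C' = C[unfolded C5_def]
  have nb: "v \<in> {p, q, r, s, t}" if "v \<in> ?B" "x \<in> {p, q, r, s, t}" "E x v" for x v
    using five_cyclesD(5)[OF fc _ that(1) that(3) P that(2)] that(2) B by blast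
  obtain \<C>1 where 1: "five_cycles \<C>1 (A - {a, p, q})"
    using remove_triangle[of a p q] T(1) B e C' by auto
  obtain \<C>2 where 2: "five_cycles \<C>2 (A - {a, q, r})"
    using remove_triangle[of a q r] T(1) B e C' by auto
  have 3: "r \<in> A - {a, p, q}" "s \<in> A - {a, p, q}" "t \<in> A - {a, p, q}"
    using B C' by auto
  have 4: "s \<in> A - {a, q, r}" "t \<in> A - {a, q, r}" "p \<in> A - {a, q, r}"
    using B C' by auto
  obtain u w where uw: "u \<in> A - {a, p, q}" "E t u" "u \<noteq> s"
    using five_cycles_path[OF 1 3] C' by auto
  have "u \<notin> {p, q, r, s, t}" using uw C' irrefl sym[of t r] by auto
  then have "u \<in> {b, c}" using nb[of u t] uw by blast
  then have "u \<in> A - {a, q, r}" using B T E_neq by blast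
  then have "u = s \<or> u = p" using five_cycles_path_nbs[OF 2 4 _ _ _ _ uw(2)] C' by auto
  then show False using uw by auto
qed

text \<open>Without such a \<open>w\<close>, extending by \<open>a\<close> yields an independent set
  of |A| - 2 - 3k vertices, one more than the gap allows.\<close>

lemma isolated_neighbour:
  assumes T: "a \<in> A" "b \<in> A" "c \<in> A" "E a b" "E b c" "E a c"
    and fc: "five_cycles \<C> (A - {a, b, c})" and card: "card \<C> = k" "card A = card (A - {a, b, c}) + 3"
  obtains w where "w \<in> A - {a, b, c} - \<Union>\<C>" "E a w"
proof (rule ccontr)
  assume no: "\<not> thesis"
  let ?B = "A - {a, b, c}"
  have B: "finite ?B" "a \<notin> ?B" using finite_gap_graph by auto
  have iso: "\<not> E a w" if "w \<in> ?B - \<Union>\<C>" for w using no \<open>\<And>w. w \<in> ?B - \<Union>\<C> \<Longrightarrow> E a w \<Longrightarrow> thesis\<close> that by blast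
  obtain S where S: "S \<subseteq> insert a ?B" "indep S" "card S + 3 * card \<C> = Suc (card ?B)"
    by (rule five_cycles_extend_indep[OF B(1) fc B(2) iso triangle_path_free[OF T fc]])
  then have "S \<subseteq> A" using T(1) by blast
  then show False using gap_graph_indep[OF _ S(2)] S(3) card by simp
qed

text \<open>The third corner \<open>c\<close> has an isolated neighbour \<open>w'\<close> as well.
  If it equals \<open>w\<close>, the clique \<open>a b c w\<close> leads to a cover with one clique
  too few. Otherwise the triangle \<open>a b w\<close> is deleted instead: the edge
  \<open>c w'\<close> puts \<open>w'\<close> on a 5-cycle of the rest, but \<open>c\<close> is its
  only possible neighbour there.\<close>

lemma isolated_neighbour_unique:
  assumes T: "a \<in> A" "b \<in> A" "c \<in> A" "E a b" "E b c" "E a c"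
    and fc: "five_cycles \<C> (A - {a, b, c})" and card: "card \<C> = k" "card A = card (A - {a, b, c}) + 3"
    and w: "w \<in> A - {a, b, c} - \<Union>\<C>" "E a w"
  shows "\<not> E b w"
proof
  assume bw: "E b w"
  let ?B = "A - {a, b, c}"
  let ?W = "?B - \<Union>\<C>"
  have isoW: "\<not> E x v" if "x \<in> ?W" "v \<in> ?B" for x v
    using five_cyclesD(6)[OF fc, of x v] five_cyclesD(5)[OF fc, of x v] that five_cyclesD(2)[OF fc]
    by blast
  obtain w' where w': "w' \<in> A - {c, a, b} - \<Union>\<C>" "E c w'"
  proof (rule isolated_neighbour[of c a b \<C>])
    have eq: "A - {c, a, b} = ?B" by blast
    show "five_cycles \<C> (A - {c, a, b})" "card A = card (A - {c, a, b}) + 3"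
      using fc card eq by simp_all
  qed (use T card sym in auto)
  then have w'W: "w' \<in> ?W" by blast
  show False
  proof (cases "w' = w")
    case True
    have is_clique: "is_clique {a, b, c, w}" using T w(2) bw w'(2) True sym by (auto simp: is_clique_def)
    have finB: "finite ?B" using finite_gap_graph by simp
    have "clique_cover (\<Union>\<C> \<union> (?W - {w})) (3 * card \<C> + card (?W - {w}))"
      by (rule clique_cover_Un_singletons[OF five_cycles_cover[OF fc]]) (use finB in simp)
    from clique_cover_insert[OF this is_clique, of A]
    have "clique_cover A (Suc (3 * card \<C> + card (?W - {w})))" by blast
    then have "card A \<le> Suc (3 * card \<C> + card (?W - {w})) + 2 * k + 2" by (rule gap_graph_cover)
    moreover have "Suc (card (?W - {w})) = card ?W" using finB w(1) by (intro card_Suc_Diff1) simp_all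
    moreover have "card ?B = card ?W + 5 * card \<C>"
      using card_Diff_subset[of "\<Union>\<C>" ?B] card_mono[of ?B "\<Union>\<C>"] card_five_cycles[OF fc]
        five_cyclesD(3)[OF fc] finB finite_subset[OF five_cyclesD(3)[OF fc] finB] by simp
    ultimately show False using card by simp
  next
    case False
    obtain \<D> where D: "five_cycles \<D> (A - {a, b, w})"
      using remove_triangle[of a b w] T w bw by blast
    have cD: "c \<in> A - {a, b, w}" "w' \<in> A - {a, b, w}" using T E_neq w w'W False by blast+
    obtain P where P: "P \<in> \<D>" "w' \<in> P" using five_cyclesD(6)[OF D cD(2) cD(1)] w'(2) sym by blast
    then obtain q r s t where C: "P = {w', q, r, s, t}" "C5 w' q r s t"
      using five_cyclesD(4)[OF D P(1)] C5_from_vertex by metis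
    have "q \<in> A - {a, b, w}" "t \<in> A - {a, b, w}" using five_cyclesD(3)[OF D] P C(1) by blast+
    moreover have "E w' q" "E w' t" "q \<noteq> t" using C(2) sym by (auto simp: C5_def)
    ultimately show False using isoW[OF w'W, of q] isoW[OF w'W, of t] by auto
  qed
qed

text \<open>The corners of a triangle have distinct neighbours \<open>x\<close>, \<open>y\<close>,
  \<open>z\<close> among the isolated vertices of the rest. The edges \<open>a x\<close>,
  \<open>b y\<close>, \<open>c z\<close> cover six vertices by three cliques, where the triangle and
  three singletons would take four; that is one clique fewer than the gap permits.\<close>

lemma gap_graph_triangle_free: "triangle_free A"
proof (rule ccontr)
  assume "\<not> triangle_free A"
  then obtain a b c where T: "a \<in> A" "b \<in> A" "c \<in> A" "E a b" "E b c" "E a c"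
    unfolding triangle_free_def by blast
  obtain \<C> where C: "five_cycles \<C> (A - {a, b, c})" "card \<C> = k" "card A = card (A - {a, b, c}) + 3"
    using remove_triangle[OF T] by blast
  let ?B = "A - {a, b, c}"
  let ?W = "?B - \<Union>\<C>"
  have perm: "A - {b, c, a} = ?B" "A - {c, a, b} = ?B" by blast+
  have T': "b \<in> A" "c \<in> A" "a \<in> A" "E b c" "E c a" "E b a"
    and T'': "c \<in> A" "a \<in> A" "b \<in> A" "E c a" "E a b" "E c b" using T sym by auto
  have C': "five_cycles \<C> (A - {b, c, a})" "card \<C> = k" "card A = card (A - {b, c, a}) + 3"
    and C'': "five_cycles \<C> (A - {c, a, b})" "card \<C> = k" "card A = card (A - {c, a, b}) + 3"
    unfolding perm using C by simp_all
  obtain x where x: "x \<in> ?W" "E a x" using isolated_neighbour[OF T C] by blast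
  obtain y where y: "y \<in> ?W" "E b y" using isolated_neighbour[OF T' C'] unfolding perm by blast
  obtain z where z: "z \<in> ?W" "E c z" using isolated_neighbour[OF T'' C''] unfolding perm by blast
  have "x \<noteq> y" using isolated_neighbour_unique[OF T C x] y by blast
  moreover have "y \<noteq> z" using isolated_neighbour_unique[OF T' C', unfolded perm, OF y] z by blast
  moreover have "z \<noteq> x" using isolated_neighbour_unique[OF T'' C'', unfolded perm, OF z] x by blast
  ultimately have xyz: "card {x, y, z} = 3" by simp
  have finB: "finite ?B" using finite_gap_graph by simp
  have 0: "clique_cover (\<Union>\<C> \<union> (?W - {x, y, z})) (3 * card \<C> + card (?W - {x, y, z}))"
    by (rule clique_cover_Un_singletons[OF five_cycles_cover[OF C(1)]]) (use finB in simp)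
  note 1 = clique_cover_insert[OF 0 is_clique_edge[OF x(2)] subset_refl]
  note 2 = clique_cover_insert[OF 1 is_clique_edge[OF y(2)] subset_refl]
  have "clique_cover A (Suc (Suc (Suc (3 * card \<C> + card (?W - {x, y, z})))))"
    by (rule clique_cover_insert[OF 2 is_clique_edge[OF z(2)]]) blast
  then have "card A \<le> Suc (Suc (Suc (3 * card \<C> + card (?W - {x, y, z})))) + 2 * k + 2"
    by (rule gap_graph_cover)
  moreover have "card (?W - {x, y, z}) + 3 = card ?W"
    using card_Diff_subset[of "{x, y, z}" ?W] card_mono[of ?W "{x, y, z}"] xyz x y z finB by simp
  moreover have "card ?B = card ?W + 5 * card \<C>"
    using card_Diff_subset[of "\<Union>\<C>" ?B] card_mono[of ?B "\<Union>\<C>"] card_five_cycles[OF C(1)]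
      five_cyclesD(3)[OF C(1)] finB finite_subset[OF five_cyclesD(3)[OF C(1)] finB] by simp
  ultimately show False using C by simp
qed

end

section \<open>Structure of the graphs with gap at most 3\<close>

text \<open>The cover by a maximum matching yields |A| \<le> d + 4k, with d missed vertices.
  Doubling the independence bound and replacing one |A| by d + 4k gives the remaining hypothesis of
  \<open>triangle_free_gap\<close>.\<close>

lemma gap_graph_matching:
  assumes gap: "gap_graph k A" and "triangle_free A" "k \<le> 3"
  obtains \<P> where "partition_on A \<P>" "card A = card \<P> + 4 * k"
    "\<And>C. C \<in> \<P> \<Longrightarrow> card C \<in> {1, 5, 13}"
    "\<And>C. C \<in> \<P> \<Longrightarrow> indep_le C ((card C + 3) div 4)"
    "\<And>C x y. C \<in> \<P> \<Longrightarrow> x \<in> C \<Longrightarrow> y \<in> A \<Longrightarrow> E x y \<Longrightarrow> y \<in> C"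
proof -
  have fin: "finite A" using gap by (simp add: gap_graph_def)
  obtain f where f: "max_matching A f" using ex_max_matching by blast
  let ?d = "card (unmatched A f)"
  have m: "matching A f" using f by (simp add: max_matching_def)
  have "card A \<le> (card A + ?d) div 2 + 2 * k"
    using gap clique_cover_matching[OF fin m] by (auto simp: gap_graph_def)
  then have nu: "card A \<le> ?d + 4 * k" by linarith
  have "2 * card S + 2 * k \<le> card A + ?d" if "S \<subseteq> A" "indep S" for S
  proof -
    have "card S + 3 * k \<le> card A" using gap that by (simp add: gap_graph_def)
    then show ?thesis using nu by linarith
  qed
  from triangle_free_gap[OF fin assms(2,3) f nu this] obtain \<P>
    where "card A = ?d + 4 * k" "partition_on A \<P>" "card \<P> = ?d"
      "\<forall>C\<in>\<P>. card C \<in> {1, 5, 13} \<and> indep_le C ((card C + 3) div 4)"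
      "\<forall>C\<in>\<P>. \<forall>x\<in>C. \<forall>y\<in>A. E x y \<longrightarrow> y \<in> C" by blast
  then show thesis by (intro that[of \<P>]) auto
qed

lemma partition_sum_excess:
  assumes "finite A" "partition_on A \<P>"
  shows "card A = card \<P> + (\<Sum>C\<in>\<P>. card C - 1)"
proof -
  have "card C = 1 + (card C - 1)" if "C \<in> \<P>" for C
  proof -
    have "finite C" "C \<noteq> {}"
      using that assms partition_onD1[OF assms(2)] partition_onD3[OF assms(2)] by (auto intro: finite_subset)
    then show ?thesis by (simp add: card_gt_0_iff Suc_le_eq)
  qed
  then have "(\<Sum>C\<in>\<P>. card C) = (\<Sum>C\<in>\<P>. 1 + (card C - 1))" by (intro sum.cong) auto
  then show ?thesis using card_partition_eq_sum[OF assms] by (simp only: sum.distrib) simp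
qed

text \<open>The excess |A| - |\<P>| = 4k is the sum of |C| - 1 over the classes, to which a 5-vertex
  class adds 4 and a single vertex nothing.\<close>

lemma five_cycles_of_partition:
  assumes fin: "finite A" and tf: "triangle_free A" and P: "partition_on A \<P>" "card A = card \<P> + 4 * k"
    and size: "\<And>C. C \<in> \<P> \<Longrightarrow> card C \<in> {1, 5}"
    and ind: "\<And>C. C \<in> \<P> \<Longrightarrow> indep_le C ((card C + 3) div 4)"
    and edge: "\<And>C x y. C \<in> \<P> \<Longrightarrow> x \<in> C \<Longrightarrow> y \<in> A \<Longrightarrow> E x y \<Longrightarrow> y \<in> C"
  shows "\<exists>\<C>. five_cycles \<C> A \<and> card \<C> = k"
proof (intro exI conjI)
  let ?C = "{C \<in> \<P>. card C = 5}"
  have finP: "finite \<P>" by (rule finite_elements[OF fin P(1)])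
  have sub: "C \<subseteq> A" if "C \<in> \<P>" for C using that partition_onD1[OF P(1)] by blast
  have "card \<P> + 4 * k = card \<P> + (\<Sum>C\<in>\<P>. card C - 1)"
    using partition_sum_excess[OF fin P(1)] P(2) by simp
  also have "(\<Sum>C\<in>\<P>. card C - 1) = (\<Sum>C\<in>\<P>. if card C = 5 then 4 else 0)"
    using size by (intro sum.cong) fastforce+
  also have "\<dots> = 4 * card ?C" using finP by (simp add: sum.inter_filter[symmetric])
  finally show "card ?C = k" by simp
  show "five_cycles ?C A"
    unfolding five_cycles_def
  proof (intro conjI ballI impI)
    show "finite ?C" using finP by simp
    show "disjoint ?C" using partition_onD2[OF P(1)] by (auto simp: disjoint_def)
    show "\<Union>?C \<subseteq> A" using sub by blast
  next
    fix C assume "C \<in> ?C"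
    then have C: "C \<in> \<P>" "card C = 5" by simp_all
    then obtain p where "p \<in> C" by fastforce
    have ind2: "indep_le C 2" using ind[OF C(1)] C(2) by simp
    obtain q r s t where "C = {p, q, r, s, t}" "C5 p q r s t"
      by (rule C5_of_indep_le_2[OF finite_subset[OF sub[OF C(1)] fin]
            triangle_free_subset[OF tf sub[OF C(1)]] ind2 C(2) \<open>p \<in> C\<close>])
    then show "\<exists>p q r s t. C = {p, q, r, s, t} \<and> C5 p q r s t" by (intro exI conjI)
  next
    fix x y assume xy: "x \<in> A" "y \<in> A" "E x y"
    then obtain C where C: "C \<in> \<P>" "x \<in> C" using partition_onD1[OF P(1)] by blast
    then have y: "y \<in> C" using edge xy by blast
    have "card C \<noteq> 1" using C y E_neq[OF xy(3)] by (auto simp: card_1_singleton_iff)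
    then have "C \<in> ?C" using size C by blast
    then show "\<exists>P\<in>?C. x \<in> P \<and> y \<in> P" using C y by blast
  qed
qed

lemma gap_graph_five_cycles:
  assumes "k \<le> 2" "gap_graph k A"
  shows "\<exists>\<C>. five_cycles \<C> A \<and> card \<C> = k"
  using assms
proof (induction k arbitrary: A)
  case (0 A)
  have "\<not> E x y" if "x \<in> A" "y \<in> A" for x y
  proof
    assume e: "E x y"
    have fin: "finite A" using 0 by (simp add: gap_graph_def)
    \<comment> \<open>An edge and singletons cover \<open>A\<close> with |A| - 1 cliques, which gap
      0 forbids.\<close>
    have "clique_cover ({} \<union> (A - {x, y})) (0 + card (A - {x, y}))"
      by (rule clique_cover_Un_singletons[OF clique_cover_empty]) (use fin in simp)
    from clique_cover_insert[OF this is_clique_edge[OF e], of A]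
    have "clique_cover A (Suc (card (A - {x, y})))" by auto
    then have "card A \<le> Suc (card (A - {x, y}))" using 0 by (auto simp: gap_graph_def)
    moreover have "card (A - {x, y}) + 2 = card A"
      using card_Diff_subset[of "{x, y}" A] card_mono[OF fin, of "{x, y}"] that E_neq[OF e] by simp
    ultimately show False by simp
  qed
  then show ?case by (intro exI[of _ "{}"]) (auto simp: five_cycles_def)
next
  case (Suc k A)
  have fin: "finite A" using Suc.prems by (simp add: gap_graph_def)
  have tf: "triangle_free A"
    using gap_graph_triangle_free[OF Suc.prems(2)] Suc.IH Suc.prems(1) by simp
  obtain \<P> where P: "partition_on A \<P>" "card A = card \<P> + 4 * Suc k"
    and size: "\<And>C. C \<in> \<P> \<Longrightarrow> card C \<in> {1, 5, 13}"
    and ind: "\<And>C. C \<in> \<P> \<Longrightarrow> indep_le C ((card C + 3) div 4)"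
    and edge: "\<And>C x y. C \<in> \<P> \<Longrightarrow> x \<in> C \<Longrightarrow> y \<in> A \<Longrightarrow> E x y \<Longrightarrow> y \<in> C"
    using gap_graph_matching[OF Suc.prems(2) tf] Suc.prems(1) by auto
  have "card C \<in> {1, 5}" if "C \<in> \<P>" for C
  proof (rule ccontr)
    assume "card C \<notin> {1, 5}"
    then have "card C = 13" using size[OF that] by blast
    \<comment> \<open>A class of 13 vertices alone has excess 12, while the total excess is at most
      8.\<close>
    then have "12 \<le> (\<Sum>C\<in>\<P>. card C - 1)"
      using member_le_sum[of C \<P> "\<lambda>C. card C - 1"] that finite_elements[OF fin P(1)] by simp
    then show False using partition_sum_excess[OF fin P(1)] P(2) Suc.prems(1) by simp
  qed
  from five_cycles_of_partition[OF fin tf P this ind edge] show ?case .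
qed

lemma gap_graph_3:
  assumes gap: "gap_graph 3 A"
  shows "(\<exists>\<C>. five_cycles \<C> A \<and> card \<C> = 3) \<or>
    (\<exists>xs. circulant_13_1_5 xs \<and> set xs \<subseteq> A \<and> (\<forall>x\<in>A. \<forall>y\<in>A. E x y \<longrightarrow> x \<in> set xs))"
proof -
  have fin: "finite A" using gap by (simp add: gap_graph_def)
  have tf: "triangle_free A"
    using gap_graph_triangle_free[of 2] gap gap_graph_five_cycles[of 2] by (simp add: eval_nat_numeral)
  obtain \<P> where P: "partition_on A \<P>" "card A = card \<P> + 4 * 3"
    and size: "\<And>C. C \<in> \<P> \<Longrightarrow> card C \<in> {1, 5, 13}"
    and ind: "\<And>C. C \<in> \<P> \<Longrightarrow> indep_le C ((card C + 3) div 4)"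
    and edge: "\<And>C x y. C \<in> \<P> \<Longrightarrow> x \<in> C \<Longrightarrow> y \<in> A \<Longrightarrow> E x y \<Longrightarrow> y \<in> C"
    using gap_graph_matching[OF gap tf] by auto
  show ?thesis
  proof (cases "\<exists>C\<in>\<P>. card C = 13")
    case False
    then have "card C \<in> {1, 5}" if "C \<in> \<P>" for C using size[OF that] that by blast
    from five_cycles_of_partition[OF fin tf P this ind edge] show ?thesis by simp
  next
    case True
    then obtain C where C: "C \<in> \<P>" "card C = 13" by blast
    have sub: "C \<subseteq> A" using C partition_onD1[OF P(1)] by blast
    have "indep_le C 4" using ind[OF C(1)] C(2) by simp
    then obtain xs where xs: "set xs = C" "circulant_13_1_5 xs"
      using circulant_of_indep_le_4[OF finite_subset[OF sub fin] triangle_free_subset[OF tf sub]] C(2)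
      by blast
    \<comment> \<open>The 13-vertex class uses up the total excess 4 * 3, so all other classes are
      single vertices.\<close>
    have "x \<in> C" if xy: "x \<in> A" "y \<in> A" "E x y" for x y
    proof (rule ccontr)
      assume "x \<notin> C"
      obtain D where D: "D \<in> \<P>" "x \<in> D" using xy partition_onD1[OF P(1)] by blast
      then have "y \<in> D" "D \<noteq> C" using edge xy \<open>x \<notin> C\<close> by blast+
      then have "card D \<noteq> 1" using D E_neq[OF xy(3)] by (auto simp: card_1_singleton_iff)
      then have "4 \<le> card D - 1" using size[OF D(1)] by auto
      moreover have "(\<Sum>D\<in>{C, D}. card D - 1) \<le> (\<Sum>C\<in>\<P>. card C - 1)"
        using C D finite_elements[OF fin P(1)] by (intro sum_mono2) auto
      ultimately show False using partition_sum_excess[OF fin P(1)] P(2) C(2) \<open>D \<noteq> C\<close> by simp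
    qed
    then show ?thesis using xs sub by blast
  qed
qed

end

subsection \<open>Back to the complement\<close>

text \<open>An isomorphism from the subgraph induced on \<open>X\<close>, kept as a bare bijection
  so that joins can be assembled on subsets of one graph before passing to
  \<open>digraph_iso\<close>.\<close>

definition induced_iso :: "'a pair_pre_digraph \<Rightarrow> 'a set \<Rightarrow> 'b pair_pre_digraph \<Rightarrow> bool" where
  "induced_iso G X H \<longleftrightarrow> (\<exists>f. bij_betw f X (pverts H) \<and>
     (\<forall>u\<in>X. \<forall>v\<in>X. (u, v) \<in> parcs G \<longleftrightarrow> (f u, f v) \<in> parcs H))"

lemma induced_isoI_inv:
  assumes g: "bij_betw g (pverts H) X"
    and e: "\<And>i j. i \<in> pverts H \<Longrightarrow> j \<in> pverts H \<Longrightarrow> (g i, g j) \<in> parcs G \<longleftrightarrow> (i, j) \<in> parcs H"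
  shows "induced_iso G X H"
  unfolding induced_iso_def
proof (intro exI conjI ballI)
  let ?f = "inv_into (pverts H) g"
  show f: "bij_betw ?f X (pverts H)" by (rule bij_betw_inv_into[OF g])
  fix u v assume u: "u \<in> X" "v \<in> X"
  then have "?f u \<in> pverts H" "?f v \<in> pverts H" using bij_betwE[OF f] by blast+
  moreover have "g (?f u) = u" "g (?f v) = v" using bij_betw_inv_into_right[OF g] u by simp_all
  ultimately show "(u, v) \<in> parcs G \<longleftrightarrow> (?f u, ?f v) \<in> parcs H" using e by metis
qed

lemma induced_iso_join:
  assumes "induced_iso G X H" "induced_iso G Y K" and d: "X \<inter> Y = {}"
    and c: "\<And>x y. x \<in> X \<Longrightarrow> y \<in> Y \<Longrightarrow> (x, y) \<in> parcs G \<and> (y, x) \<in> parcs G"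
  shows "induced_iso G (X \<union> Y) (H +\<^sub>G K)"
proof -
  obtain f g where f: "bij_betw f X (pverts H)"
      "\<forall>u\<in>X. \<forall>v\<in>X. (u, v) \<in> parcs G \<longleftrightarrow> (f u, f v) \<in> parcs H"
    and g: "bij_betw g Y (pverts K)"
      "\<forall>u\<in>Y. \<forall>v\<in>Y. (u, v) \<in> parcs G \<longleftrightarrow> (g u, g v) \<in> parcs K"
    using assms(1,2) by (auto simp: induced_iso_def)
  let ?h = "\<lambda>u. if u \<in> X then Inl (f u) else Inr (g u)"
  have "bij_betw ?h X (Inl ` pverts H)" using f(1) by (auto simp: bij_betw_def inj_on_def)
  moreover have "bij_betw (\<lambda>u. Inr (g u)) Y (Inr ` pverts K)"
    using g(1) by (auto simp: bij_betw_def inj_on_def)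
  then have "bij_betw ?h Y (Inr ` pverts K)"
    by (rule bij_betw_cong[THEN iffD1, rotated]) (use d in auto)
  ultimately have "bij_betw ?h (X \<union> Y) (pverts (H +\<^sub>G K))"
    unfolding graph_join_def by (auto simp: Plus_def intro!: bij_betw_combine)
  moreover have "(u, v) \<in> parcs G \<longleftrightarrow> (?h u, ?h v) \<in> parcs (H +\<^sub>G K)"
    if u: "u \<in> X \<union> Y" and v: "v \<in> X \<union> Y" for u v
  proof -
    have fX: "w \<in> X \<Longrightarrow> f w \<in> pverts H" and gY: "w \<in> Y \<Longrightarrow> g w \<in> pverts K" for w
      using f(1) g(1) by (auto dest: bij_betwE)
    have Y: "w \<in> Y \<Longrightarrow> w \<notin> X" for w using d by blast
    consider "u \<in> X" "v \<in> X" | "u \<in> X" "v \<in> Y" | "u \<in> Y" "v \<in> X" | "u \<in> Y" "v \<in> Y"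
      using u v by blast
    then show ?thesis
    proof cases
      case 1 then show ?thesis using f(2) by (auto simp: graph_join_def)
    next
      case 2 then show ?thesis using c fX gY Y by (auto simp: graph_join_def)
    next
      case 3 then show ?thesis using c fX gY Y by (auto simp: graph_join_def)
    next
      case 4 then show ?thesis using g(2) Y by (auto simp: graph_join_def)
    qed
  qed
  ultimately show ?thesis unfolding induced_iso_def by blast
qed

lemma induced_iso_complete:
  assumes "finite X" "\<And>u v. u \<in> X \<Longrightarrow> v \<in> X \<Longrightarrow> (u, v) \<in> parcs G \<longleftrightarrow> u \<noteq> v"
  shows "induced_iso G X (complete_graph (card X))"
proof -
  obtain f where f: "bij_betw f X {0..<card X}" using ex_bij_betw_finite_nat[OF assms(1)] by blast
  have "(u, v) \<in> parcs G \<longleftrightarrow> (f u, f v) \<in> parcs (complete_graph (card X))"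
    if "u \<in> X" "v \<in> X" for u v
    using that assms(2) bij_betwE[OF f] bij_betw_imp_inj_on[OF f]
    by (auto simp: complete_graph_def inj_on_eq_iff)
  then show ?thesis using f unfolding induced_iso_def by (intro exI[of _ f]) (simp add: complete_graph_def)
qed

lemma eq_add_mod_iff_cong:
  fixes i j c n :: nat
  assumes "j < n"
  shows "j = (i + c) mod n \<longleftrightarrow> [int i - int j = - int c] (mod int n)"
proof -
  have "j = (i + c) mod n \<longleftrightarrow> [int j = int (i + c)] (mod int n)"
    unfolding cong_int_iff using assms by (simp add: cong_def)
  also have "\<dots> \<longleftrightarrow> int n dvd - (int i - int j - - int c)"
    unfolding cong_iff_dvd_diff by (simp add: algebra_simps)
  also have "\<dots> \<longleftrightarrow> [int i - int j = - int c] (mod int n)"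
    unfolding cong_iff_dvd_diff by (rule dvd_minus_iff)
  finally show ?thesis .
qed

lemma circulant_offsets_cong:
  fixes i j :: nat
  assumes "j < 13"
  shows "j \<in> {(i + 1) mod 13, (i + 5) mod 13, (i + 8) mod 13, (i + 12) mod 13} \<longleftrightarrow>
    (\<exists>s\<in>{1, -1, 5, -5}. [int i - int j = s] (mod 13))"
proof -
  \<comment> \<open>Modulo 13, -8 is 5 and -12 is 1; the offsets 1 and 5 give -1 and -5
    directly.\<close>
  have "[x = - 8] (mod 13) \<longleftrightarrow> [x = 5] (mod 13)" "[x = - 12] (mod 13) \<longleftrightarrow> [x = 1] (mod 13)" for x :: int
    by (simp_all add: cong_def)
  then show ?thesis
    using eq_add_mod_iff_cong[OF assms, of i 1] eq_add_mod_iff_cong[OF assms, of i 5]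
      eq_add_mod_iff_cong[OF assms, of i 8] eq_add_mod_iff_cong[OF assms, of i 12]
    unfolding insert_iff empty_iff bex_simps by simp blast
qed

text \<open>Each vertex takes the number of one chosen class containing it, so overlapping classes
  do no harm; clique covers of the complement may overlap.\<close>

lemma chromatic_number_le:
  assumes "\<And>v. v \<in> pverts G \<Longrightarrow> \<exists>K\<in>\<K>. v \<in> K" "finite \<K>"
    and "\<And>K u v. K \<in> \<K> \<Longrightarrow> u \<in> K \<Longrightarrow> v \<in> K \<Longrightarrow> (u, v) \<notin> parcs G"
    and wf: "parcs G \<subseteq> pverts G \<times> pverts G"
  shows "chromatic_number G \<le> card \<K>"
proof -
  obtain h where h: "bij_betw h \<K> {0..<card \<K>}" using ex_bij_betw_finite_nat[OF assms(2)] by blast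
  obtain k where k: "\<And>v. v \<in> pverts G \<Longrightarrow> k v \<in> \<K> \<and> v \<in> k v" using assms(1) by metis
  have "proper_coloring G (card \<K>) (h \<circ> k)"
    unfolding proper_coloring_def
  proof (intro conjI ballI, goal_cases)
    case (1 v) then show ?case using k bij_betwE[OF h] by fastforce
  next
    case (2 e)
    obtain u v where e: "e = (u, v)" by (cases e)
    then have uv: "(u, v) \<in> parcs G" "u \<in> pverts G" "v \<in> pverts G" using 2 wf by auto
    have "k u \<noteq> k v" using assms(3)[of "k u" u v] k uv by metis
    then show ?case using e k uv bij_betw_imp_inj_on[OF h] by (auto simp: inj_on_eq_iff)
  qed
  then show ?thesis unfolding chromatic_number_def by (intro Least_le) blast
qed

lemma clique_number_ge:
  assumes "finite (pverts G)" "clique G S"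
  shows "card S \<le> clique_number G"
proof -
  have "finite {S. clique G S}"
    by (rule finite_subset[of _ "Pow (pverts G)"]) (auto simp: clique_def assms)
  then show ?thesis unfolding clique_number_def using assms(2) by (intro Max_ge) auto
qed

theorem theorem1p4:
  fixes G :: "'a pair_pre_digraph"
  assumes "pair_graph G"
    and "int (chromatic_number G) - int (clique_number G) \<ge> 3"
    and "card (pverts G) = chromatic_number G + 6"
  shows "(chromatic_number G \<ge> 7 \<and>
            G \<cong>\<^sub>G complete_graph (chromatic_number G - 7) +\<^sub>G Q_graph) \<or>
         (chromatic_number G \<ge> 9 \<and>
            G \<cong>\<^sub>G complete_graph (chromatic_number G - 9)
                  +\<^sub>G cycle_graph 5 +\<^sub>G cycle_graph 5 +\<^sub>G cycle_graph 5)"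
proof -
  interpret G: pair_graph G by fact
  let ?V = "pverts G" and ?\<chi> = "chromatic_number G"
  define E where "E u v \<longleftrightarrow> u \<in> ?V \<and> v \<in> ?V \<and> u \<noteq> v \<and> (u, v) \<notin> parcs G" for u v
  interpret adjacency E
  proof
    show "E y x" if "E x y" for x y using that G.arcs_symmetric by (auto simp: E_def)
    show "\<not> E x x" for x by (simp add: E_def)
  qed
  have wf: "parcs G \<subseteq> ?V \<times> ?V" using G.in_arcsD1 G.in_arcsD2 by fastforce
  have adj: "(u, v) \<in> parcs G \<longleftrightarrow> u \<noteq> v \<and> \<not> E u v" if "u \<in> ?V" "v \<in> ?V" for u v
    using that by (cases "u = v") (auto simp: E_def dest: G.no_loops)
  have fin: "finite ?V" by simp
  \<comment> \<open>For k = 3 the two conditions become \<chi> \<ge> |V| - 6 and \<omega> \<le>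
    \<chi> - 3 = |V| - 9.\<close>
  have gap: "gap_graph 3 ?V"
    unfolding gap_graph_def
  proof (intro conjI allI impI fin)
    fix m assume "clique_cover ?V m"
    then obtain \<K> where K: "finite \<K>" "card \<K> \<le> m" "\<forall>K\<in>\<K>. is_clique K" "?V \<subseteq> \<Union>\<K>"
      by (auto simp: clique_cover_def)
    have "?\<chi> \<le> card \<K>"
    proof (rule chromatic_number_le[OF _ K(1) _ wf])
      show "\<exists>K\<in>\<K>. v \<in> K" if "v \<in> ?V" for v using that K(4) by blast
      show "(u, v) \<notin> parcs G" if "K \<in> \<K>" "u \<in> K" "v \<in> K" for K u v
      proof
        assume "(u, v) \<in> parcs G"
        then have "u \<noteq> v" by (auto dest: G.no_loops)
        then have "E u v" using that K(3) unfolding is_clique_def by blast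
        then show False using \<open>(u, v) \<in> parcs G\<close> by (simp add: E_def)
      qed
    qed
    then show "card ?V \<le> m + 2 * 3" using K(2) assms(3) by simp
  next
    fix S assume S: "S \<subseteq> ?V" "indep S"
    then have "clique G S" using adj unfolding clique_def indep_def by blast
    then have "card S \<le> clique_number G" by (rule clique_number_ge[OF fin])
    then show "card S + 3 * 3 \<le> card ?V" using assms(2,3) by linarith
  qed
  have complete: "induced_iso G W (complete_graph (card W))"
    if "W \<subseteq> ?V" "\<And>x y. x \<in> W \<Longrightarrow> y \<in> ?V \<Longrightarrow> \<not> E x y" for W
  proof (rule induced_iso_complete)
    show "finite W" using that(1) fin by (rule finite_subset)
    show "(u, v) \<in> parcs G \<longleftrightarrow> u \<noteq> v" if "u \<in> W" "v \<in> W" for u v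
      using adj[of u v] that \<open>W \<subseteq> ?V\<close> \<open>\<And>x y. x \<in> W \<Longrightarrow> y \<in> ?V \<Longrightarrow> \<not> E x y\<close> by blast
  qed
  have joinI: "induced_iso G (X \<union> Y) (H +\<^sub>G K)"
    if "induced_iso G X H" "induced_iso G Y K" "X \<inter> Y = {}" "X \<subseteq> ?V" "Y \<subseteq> ?V"
      "\<And>x y. x \<in> X \<Longrightarrow> y \<in> Y \<Longrightarrow> \<not> E x y" for X Y and H :: "'b pair_pre_digraph" and K :: "'c pair_pre_digraph"
  proof (rule induced_iso_join[OF that(1-3)])
    fix x y assume xy: "x \<in> X" "y \<in> Y"
    then have "x \<in> ?V" "y \<in> ?V" "x \<noteq> y" "\<not> E x y" "\<not> E y x" using that(3-6) sym by blast+
    then show "(x, y) \<in> parcs G \<and> (y, x) \<in> parcs G" using adj by simp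
  qed
  have iso: "G \<cong>\<^sub>G H" if "induced_iso G ?V H" "pair_graph H" for H :: "'b pair_pre_digraph"
    using graph_iso_iff[OF assms(1) that(2)] that(1) by (simp add: induced_iso_def)
  from gap_graph_3[OF gap] show ?thesis
  proof
    assume "\<exists>\<C>. five_cycles \<C> ?V \<and> card \<C> = 3"
    then obtain \<C> where C: "five_cycles \<C> ?V" "card \<C> = 3" by blast
    let ?W = "?V - \<Union>\<C>"
    have sub: "\<Union>\<C> \<subseteq> ?V" using five_cyclesD(3)[OF C(1)] .
    \<comment> \<open>Three 5-cycles take 15 of the \<chi> + 6 vertices. The additive form also
      yields \<chi> \<ge> 9.\<close>
    have cW: "card ?W + 15 = ?\<chi> + 6"
      using card_Diff_subset[of "\<Union>\<C>" ?V] card_mono[OF fin sub] card_five_cycles[OF C(1)] C(2)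
        finite_subset[OF sub fin] sub assms(3) by simp
    have isoW: "induced_iso G ?W (complete_graph (?\<chi> - 9))"
    proof -
      have "induced_iso G ?W (complete_graph (card ?W))"
        by (rule complete) (use five_cyclesD(5,6)[OF C(1)] in blast)+
      moreover have "card ?W = ?\<chi> - 9" using cW by simp
      ultimately show ?thesis by simp
    qed
    have cyc: "induced_iso G P (cycle_graph 5)" if P: "P \<in> \<C>" for P
    proof -
      obtain p q r s t where p: "P = {p, q, r, s, t}" "C5 p q r s t" using five_cyclesD(4)[OF C(1) P] by blast
      let ?xs = "[p, r, t, q, s]"
      have xs: "set ?xs = P" unfolding p(1) by auto
      have PV: "P \<subseteq> ?V" using sub P by blast
      show ?thesis
      proof (rule induced_isoI_inv)
        have "bij_betw ((!) ?xs) {0..<5} P"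
          by (rule bij_betw_nth) (use p in \<open>auto simp: C5_def\<close>)
        then show "bij_betw ((!) ?xs) (pverts (cycle_graph 5)) P"
          by (simp add: cycle_graph_def)
        fix i j assume "i \<in> pverts (cycle_graph 5)" "j \<in> pverts (cycle_graph 5)"
        then have ij: "i < 5" "j < 5" by (simp_all add: cycle_graph_def)
        have "?xs ! k \<in> ?V" if "k < 5" for k using nth_mem[of k ?xs] that PV unfolding xs by auto
        from adj[OF this this, OF ij] show "(?xs ! i, ?xs ! j) \<in> parcs G \<longleftrightarrow> (i, j) \<in> parcs (cycle_graph 5)"
          using C5_complement[OF p(2) ij] ij by (simp add: cycle_graph_def)
      qed
    qed
    obtain P1 P2 P3 where P: "\<C> = {P1, P2, P3}" "P1 \<noteq> P2" "P2 \<noteq> P3" "P1 \<noteq> P3"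
      using C(2) by (auto simp: card_3_iff)
    have disj: "P1 \<inter> P2 = {}" "P1 \<inter> P3 = {}" "P2 \<inter> P3 = {}"
      using five_cyclesD(2)[OF C(1)] P by (auto simp: disjoint_def)
    have PV: "P1 \<subseteq> ?V" "P2 \<subseteq> ?V" "P3 \<subseteq> ?V" using sub P(1) by blast+
    have WP: "\<not> E x y" if "x \<in> ?W" "y \<in> ?V" for x y
      using five_cyclesD(5,6)[OF C(1)] that by blast
    have PP: "\<not> E x y" if "x \<in> P" "y \<in> P'" "P \<in> \<C>" "P' \<in> \<C>" "P \<inter> P' = {}" for x y P P'
      using five_cyclesD(5)[OF C(1), of x y P] that sub by blast
    have inC: "P1 \<in> \<C>" "P2 \<in> \<C>" "P3 \<in> \<C>" using P(1) by simp_all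
    have X1: "induced_iso G (?W \<union> P1) (complete_graph (?\<chi> - 9) +\<^sub>G cycle_graph 5)"
      by (rule joinI[OF isoW cyc]) (use P PV WP in auto)
    have X2: "induced_iso G (?W \<union> P1 \<union> P2) (complete_graph (?\<chi> - 9) +\<^sub>G cycle_graph 5 +\<^sub>G cycle_graph 5)"
    proof (rule joinI[OF X1 cyc[OF inC(2)]])
      show "(?W \<union> P1) \<inter> P2 = {}" using inC disj by blast
      show "?W \<union> P1 \<subseteq> ?V" "P2 \<subseteq> ?V" using PV by blast+
      fix x y assume "x \<in> ?W \<union> P1" "y \<in> P2"
      then show "\<not> E x y" using WP[of x y] PP[of x P1 y P2] PV inC disj by blast
    qed
    have "induced_iso G (?W \<union> P1 \<union> P2 \<union> P3)
        (complete_graph (?\<chi> - 9) +\<^sub>G cycle_graph 5 +\<^sub>G cycle_graph 5 +\<^sub>G cycle_graph 5)"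
    proof (rule joinI[OF X2 cyc[OF inC(3)]])
      show "(?W \<union> P1 \<union> P2) \<inter> P3 = {}" using inC disj by blast
      show "?W \<union> P1 \<union> P2 \<subseteq> ?V" "P3 \<subseteq> ?V" using PV by blast+
      fix x y assume "x \<in> ?W \<union> P1 \<union> P2" "y \<in> P3"
      then show "\<not> E x y"
        using WP[of x y] PP[of x P1 y P3] PP[of x P2 y P3] PV inC disj by blast
    qed
    moreover have "?W \<union> P1 \<union> P2 \<union> P3 = ?V" using P(1) sub by auto
    ultimately have "induced_iso G ?V
        (complete_graph (?\<chi> - 9) +\<^sub>G cycle_graph 5 +\<^sub>G cycle_graph 5 +\<^sub>G cycle_graph 5)" by simp
    then have "G \<cong>\<^sub>G complete_graph (?\<chi> - 9) +\<^sub>G cycle_graph 5 +\<^sub>G cycle_graph 5 +\<^sub>G cycle_graph 5"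
      by (rule iso) (intro pair_graph_graph_join pair_graph_complete_graph pair_graph_cycle_graph, simp_all)
    moreover have "?\<chi> \<ge> 9" using cW by simp
    ultimately show ?thesis by blast
  next
    assume "\<exists>xs. circulant_13_1_5 xs \<and> set xs \<subseteq> ?V \<and> (\<forall>x\<in>?V. \<forall>y\<in>?V. E x y \<longrightarrow> x \<in> set xs)"
    then obtain xs where xs: "circulant_13_1_5 xs" "set xs \<subseteq> ?V"
      and edge: "\<And>x y. x \<in> ?V \<Longrightarrow> y \<in> ?V \<Longrightarrow> E x y \<Longrightarrow> x \<in> set xs" by blast
    have len: "length xs = 13" "distinct xs" using xs(1) by (simp_all add: circulant_13_1_5_def)
    let ?W = "?V - set xs"
    have cW: "card ?W + 13 = ?\<chi> + 6"
      using card_Diff_subset[of "set xs" ?V] card_mono[OF fin xs(2)] distinct_card[OF len(2)] len(1) xs(2)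
        assms(3) by simp
    have isoW: "induced_iso G ?W (complete_graph (?\<chi> - 7))"
    proof -
      have "induced_iso G ?W (complete_graph (card ?W))"
        by (rule complete) (use edge in blast)+
      moreover have "card ?W = ?\<chi> - 7" using cW by simp
      ultimately show ?thesis by simp
    qed
    have isoQ: "induced_iso G (set xs) Q_graph"
    proof (rule induced_isoI_inv)
      have "bij_betw nat {0..<13} {..<13}"
        by (rule bij_betw_byWitness[where f' = int]) auto
      moreover have "bij_betw ((!) xs) {..<13} (set xs)" by (rule bij_betw_nth) (simp_all add: len)
      ultimately have "bij_betw ((!) xs \<circ> nat) {0..<13} (set xs)" by (rule bij_betw_trans)
      then show "bij_betw ((!) xs \<circ> nat) (pverts Q_graph) (set xs)" by (simp add: Q_graph_def)
      fix i j assume "i \<in> pverts Q_graph" "j \<in> pverts Q_graph"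
      then obtain a b where ab: "i = int a" "j = int b" "a < 13" "b < 13"
        by (auto simp: Q_graph_def elim!: nonneg_int_cases)
      have V: "xs ! a \<in> ?V" "xs ! b \<in> ?V" using xs(2) ab len by auto
      have "xs ! a = xs ! b \<longleftrightarrow> a = b" using nth_eq_iff_index_eq[OF len(2)] ab len by simp
      \<comment> \<open>The complement has its edges at the differences 1, -1, 5, -5, exactly the
        pairs that \<open>Q_graph\<close> leaves out.\<close>
      moreover have "E (xs ! a) (xs ! b) \<longleftrightarrow> (\<exists>s\<in>{1, -1, 5, -5}. [int a - int b = s] (mod 13))"
        using xs(1) ab circulant_offsets_cong[OF ab(4)] unfolding circulant_13_1_5_def by blast
      ultimately show "(((!) xs \<circ> nat) i, ((!) xs \<circ> nat) j) \<in> parcs G \<longleftrightarrow> (i, j) \<in> parcs Q_graph"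
        using adj[OF V] ab by (auto simp: Q_graph_def)
    qed
    have "induced_iso G (?W \<union> set xs) (complete_graph (?\<chi> - 7) +\<^sub>G Q_graph)"
      by (rule joinI[OF isoW isoQ]) (use xs(2) edge in blast)+
    moreover have "?W \<union> set xs = ?V" using xs(2) by blast
    ultimately have "induced_iso G ?V (complete_graph (?\<chi> - 7) +\<^sub>G Q_graph)" by simp
    then have "G \<cong>\<^sub>G complete_graph (?\<chi> - 7) +\<^sub>G Q_graph"
      by (rule iso) (intro pair_graph_graph_join pair_graph_complete_graph pair_graph_Q_graph)
    moreover have "?\<chi> \<ge> 7" using cW by simp
    ultimately show ?thesis by blast
  qed
qed

end
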